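(* Let $B_1$ be a complex Banach space and let $P_1$ be a set of representatives for $\mathfrak{F}_{B_1}$. Assume the following two conditions: (i) $B_1$ satisfies the condition of the Hausdorff distance; (ii) $M_{p,\alpha}=\{a\in S(B_1):p(a)=\alpha\}$ for every $p\in P_1$ and every $\alpha\in\mathbb{C}$ with $|\alpha|\le 1$. Then $B_1$ satisfies the complex Mazur-Ulam property.
   Context: For a complex Banach space $B$, $S(B)=\{a\in B:\|a\|=1\}$ and $\mathfrak{F}_B$ is the family of all maximal convex subsets of $S(B)$. Let $\mathbb{T}=\{z\in\mathbb{C}:|z|=1\}$. Let $Q$ be the set of all extreme points $p$ of the closed unit ball of the dual space $B^*$ such that $p^{-1}(1)\cap S(B)\in\mathfrak{F}_B$. (Every $F\in\mathfrak{F}_B$ is of the form $p^{-1}(1)\cap S(B)$ for some $p\in Q$.) For $p_1,p_2\in Q$ write $p_1\sim p_2$ if there is $\gamma\in\mathbb{T}$ with $p_1^{-1}(1)\cap S(B)=(\gamma p_2)^{-1}(1)\cap S(B)$; this is an equivalence relation on $Q$. A set of representatives for $\mathfrak{F}_B$ is a subset $P\subset Q$ containing exactly one element of each equivalence class of $\sim$. For $p\in Q$ and $\lambda\in\mathbb{T}$ put $F_{p,\lambda}=\{a\in S(B):p(a)=\lambda\}$. For nonempty closed subsets $K,L$ of $B$, the Hausdorff distance is $d_H(K,L)=\max\{\sup_{a\in K}d(a,L),\ \sup_{b\in L}d(b,K)\}$, where $d(a,L)=\inf_{b\in L}\|a-b\|$. $B$ satisfies the condition of the Hausdorff distance if for all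 $q,q'\in Q$ and $\lambda,\lambda'\in\mathbb{T}$: $d_H(F_{q,\lambda},F_{q',\lambda'})=|\lambda-\gamma\lambda'|$ whenever $\gamma\in\mathbb{T}$ satisfies $q^{-1}(1)\cap S(B)=(\gamma q')^{-1}(1)\cap S(B)$, and $d_H(F_{q,\lambda},F_{q',\lambda'})=2$ whenever $q\not\sim q'$. Equivalently, for a set of representatives $P$ and $p,p'\in P$: $d_H(F_{p,\lambda},F_{p',\lambda'})=|\lambda-\lambda'|$ if $p=p'$ and $=2$ if $p\ne p'$. For $p\in P$ and $\alpha\in\mathbb{C}$ with $|\alpha|\le1$, put $M_{p,\alpha}=\{a\in S(B): d(a,F_{p,\alpha/|\alpha|})\le 1-|\alpha|,\ d(a,F_{p,-\alpha/|\alpha|})\le 1+|\alpha|\}$, where $\alpha/|\alpha|$ is read as $1$ if $\alpha=0$. A complex Banach space $B_1$ satisfies the complex Mazur-Ulam property if, for every complex Banach space $B_2$, every surjective isometry $S(B_1)\to S(B_2)$ (with respect to the norm metrics, no linearity assumed) extends to a surjective real-linear isometry $B_1\to B_2$. *)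

theory Defs
  imports "HOL-Analysis.Analysis"
begin

text \<open>
  Complex Banach spaces: the real structure is that of \<^class>\<open>banach\<close>, and the complex
  scalar multiplication extends the real one.
\<close>

class complex_banach = banach +
  fixes scaleC :: "complex \<Rightarrow> 'a \<Rightarrow> 'a"  (infixr "*\<^sub>C" 75)
  assumes scaleC_add_right: "c *\<^sub>C (x + y) = c *\<^sub>C x + c *\<^sub>C y"
    and scaleC_add_left: "(c + d) *\<^sub>C x = c *\<^sub>C x + d *\<^sub>C x"
    and scaleC_scaleC: "c *\<^sub>C d *\<^sub>C x = (c * d) *\<^sub>C x"
    and scaleC_of_real: "complex_of_real r *\<^sub>C x = r *\<^sub>R x"
    and norm_scaleC: "norm (c *\<^sub>C x) = cmod c * norm x"

definition max_convex_subsets :: "'a::complex_banach set set" where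
  "max_convex_subsets = {F. F \<subseteq> sphere 0 1 \<and> convex F \<and>
     (\<forall>G. G \<subseteq> sphere 0 1 \<and> convex G \<and> F \<subseteq> G \<longrightarrow> G = F)}"

text \<open>
  The dual space sits inside the real-linear bounded maps \<^typ>\<open>'a \<Rightarrow>\<^sub>L complex\<close>; a complex
  linear functional has the same operator norm whether viewed over the reals or over the
  complex numbers, so \<^const>\<open>norm\<close> is the dual norm.
\<close>

definition complex_dual :: "('a::complex_banach \<Rightarrow>\<^sub>L complex) set" where
  "complex_dual = {p. \<forall>c a. blinfun_apply p (c *\<^sub>C a) = c * blinfun_apply p a}"

definition dual_unit_ball :: "('a::complex_banach \<Rightarrow>\<^sub>L complex) set" where
  "dual_unit_ball = {p \<in> complex_dual. norm p \<le> 1}"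

definition face :: "('a::complex_banach \<Rightarrow> complex) \<Rightarrow> 'a set" where
  "face f = f -` {1} \<inter> sphere 0 1"

definition Qset :: "('a::complex_banach \<Rightarrow>\<^sub>L complex) set" where
  "Qset = {p. p extreme_point_of dual_unit_ball \<and> face (blinfun_apply p) \<in> max_convex_subsets}"

definition same_face_by ::
    "complex \<Rightarrow> ('a::complex_banach \<Rightarrow>\<^sub>L complex) \<Rightarrow> ('a \<Rightarrow>\<^sub>L complex) \<Rightarrow> bool" where
  "same_face_by \<gamma> p q \<longleftrightarrow>
     face (blinfun_apply p) = face (\<lambda>a. \<gamma> * blinfun_apply q a)"

definition face_equiv ::
    "(('a::complex_banach \<Rightarrow>\<^sub>L complex) \<times> ('a \<Rightarrow>\<^sub>L complex)) set" where
  "face_equiv = {(p, q). p \<in> Qset \<and> q \<in> Qset \<and> (\<exists>\<gamma>\<in>sphere 0 1. same_face_by \<gamma> p q)}"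

definition set_of_representatives :: "('a::complex_banach \<Rightarrow>\<^sub>L complex) set \<Rightarrow> bool" where
  "set_of_representatives P \<longleftrightarrow>
     P \<subseteq> Qset \<and> (\<forall>C \<in> Qset // face_equiv. \<exists>!p. p \<in> P \<inter> C)"

definition Fset :: "('a::complex_banach \<Rightarrow>\<^sub>L complex) \<Rightarrow> complex \<Rightarrow> 'a set" where
  "Fset p l = {a \<in> sphere 0 1. blinfun_apply p a = l}"

text \<open>
  Meaningful for nonempty bounded sets only, since \<^const>\<open>Sup\<close> on the reals and
  \<^const>\<open>infdist\<close> have default values otherwise. It is applied below to the sets
  \<^term>\<open>Fset p l\<close> with \<^prop>\<open>p \<in> Qset\<close> and \<^prop>\<open>cmod l = 1\<close>, which are bounded, and
  nonempty unless the space is zero.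
\<close>

definition hausdorff_distance :: "'a::metric_space set \<Rightarrow> 'a set \<Rightarrow> real" where
  "hausdorff_distance K L = max (SUP a\<in>K. infdist a L) (SUP b\<in>L. infdist b K)"

definition hausdorff_distance_condition :: "'a::complex_banach itself \<Rightarrow> bool" where
  "hausdorff_distance_condition (_ :: 'a itself) \<longleftrightarrow>
     (\<forall>q \<in> (Qset :: ('a \<Rightarrow>\<^sub>L complex) set). \<forall>q' \<in> Qset. \<forall>l \<in> sphere 0 1. \<forall>l' \<in> sphere 0 1.
        (\<forall>\<gamma> \<in> sphere 0 1. same_face_by \<gamma> q q' \<longrightarrow>
           hausdorff_distance (Fset q l) (Fset q' l') = cmod (l - \<gamma> * l')) \<and>
        ((q, q') \<notin> face_equiv \<longrightarrow>
           hausdorff_distance (Fset q l) (Fset q' l') = 2))"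

definition phase :: "complex \<Rightarrow> complex" where
  "phase \<alpha> = (if \<alpha> = 0 then 1 else \<alpha> / complex_of_real (cmod \<alpha>))"

definition Mset :: "('a::complex_banach \<Rightarrow>\<^sub>L complex) \<Rightarrow> complex \<Rightarrow> 'a set" where
  "Mset p \<alpha> = {a \<in> sphere 0 1.
     infdist a (Fset p (phase \<alpha>)) \<le> 1 - cmod \<alpha> \<and>
     infdist a (Fset p (- phase \<alpha>)) \<le> 1 + cmod \<alpha>}"

text \<open>
  The second space is a parameter of the property; a theorem stated with \<^typ>\<open>'b\<close> free
  asserts it for every complex Banach space.
\<close>

definition complex_mazur_ulam_property ::
    "'a::complex_banach itself \<Rightarrow> 'b::complex_banach itself \<Rightarrow> bool" where
  "complex_mazur_ulam_property (_ :: 'a itself) (_ :: 'b itself) \<longleftrightarrow>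
     (\<forall>T :: 'a \<Rightarrow> 'b.
        T ` sphere 0 1 = sphere 0 1 \<and>
        (\<forall>x \<in> sphere 0 1. \<forall>y \<in> sphere 0 1. dist (T x) (T y) = dist x y) \<longrightarrow>
        (\<exists>U :: 'a \<Rightarrow> 'b. linear U \<and> surj U \<and> (\<forall>x y. dist (U x) (U y) = dist x y) \<and>
           (\<forall>x \<in> sphere 0 1. U x = T x)))"

end

theory Submission
  imports Defs
begin

text \<open>
  A surjective isometry \<open>T\<close> of unit spheres carries maximal convex sets to maximal convex sets.
  Every maximal convex set of the second sphere is the face of an extreme functional \<open>q\<close>;
  the preimages of the sets \<open>q = \<lambda>\<close>, \<open>\<lambda>\<close> on the circle, are faces of the first space at
  Hausdorff distances \<open>\<bar>\<lambda> - \<lambda>'\<bar>\<close>, so by (i) they all belong to one representative \<open>p\<close>, and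
  they are indexed by an isometry of the circle, the restriction of a real-linear isometry \<open>R\<close>
  of the complex plane. By (ii) and the triangle inequality \<open>q (T a) = R (p a)\<close> on the whole
  sphere. Hence \<open>q \<circ> U = R \<circ> p\<close> for the positively homogeneous extension \<open>U\<close> of \<open>T\<close>, and \<open>U\<close> is
  real-linear because such functionals \<open>q\<close> separate points.
\<close>

section \<open>Extreme functionals below a sublinear functional\<close>

text \<open>Homogeneity is demanded only as an inequality, which is the convenient thing to check
  for an infimum; \<open>sublinear_scale\<close> recovers equality by scaling back with
  \<open>inverse t\<close>.\<close>

definition sublinear :: "('a::real_vector \<Rightarrow> real) \<Rightarrow> bool" where
  "sublinear s \<longleftrightarrow> (\<forall>x y. s (x + y) \<le> s x + s y) \<and> (\<forall>t>0. \<forall>x. s (t *\<^sub>R x) \<le> t * s x)"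

lemma sublinear_add: "sublinear s \<Longrightarrow> s (x + y) \<le> s x + s y"
  by (simp add: sublinear_def)

lemma sublinear_zero:
  assumes "sublinear s" shows "s 0 = 0"
proof -
  have "s ((1/2) *\<^sub>R 0) \<le> (1/2) * s 0" "s (2 *\<^sub>R 0) \<le> 2 * s 0"
    using assms unfolding sublinear_def by (metis half_gt_zero zero_less_one, metis zero_less_numeral)
  then show ?thesis by simp
qed

lemma sublinear_scale:
  assumes "sublinear s" "0 \<le> t" shows "s (t *\<^sub>R x) = t * s x"
proof (cases "t = 0")
  case True
  then show ?thesis using sublinear_zero[OF assms(1)] by simp
next
  case False
  then have t: "t > 0" using assms by simp
  have "s (t *\<^sub>R x) \<le> t * s x" "s (inverse t *\<^sub>R (t *\<^sub>R x)) \<le> inverse t * s (t *\<^sub>R x)"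
    using assms(1) t unfolding sublinear_def by (blast, metis positive_imp_inverse_positive)
  moreover have "inverse t *\<^sub>R (t *\<^sub>R x) = x" using t by simp
  ultimately show ?thesis using t by (simp add: field_simps)
qed

lemma sublinear_minus: "sublinear s \<Longrightarrow> - s (- x) \<le> s x"
  using sublinear_add[of s x "- x"] sublinear_zero[of s] by simp

text \<open>Oddness turns subadditivity at \<open>- x\<close> and \<open>- y\<close> into
  superadditivity at \<open>x\<close> and \<open>y\<close>.\<close>

lemma sublinear_linear:
  assumes "sublinear s" "\<And>x. s (- x) \<le> - s x" shows "linear s"
proof -
  have neg: "s (- x) = - s x" for x
    using sublinear_minus[OF assms(1), of x] assms(2)[of x] by simp
  show ?thesis
  proof (rule linearI)
    fix x y
    have "s (- (x + y)) \<le> s (- x) + s (- y)"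
      using sublinear_add[OF assms(1), of "- x" "- y"] by (simp add: add.commute)
    then show "s (x + y) = s x + s y"
      using sublinear_add[OF assms(1), of x y] unfolding neg by linarith
  next
    fix t x
    show "s (t *\<^sub>R x) = t *\<^sub>R s x"
    proof (cases "0 \<le> t")
      case True
      then show ?thesis using sublinear_scale[OF assms(1)] by simp
    next
      case False
      then have "s ((- t) *\<^sub>R x) = - t * s x" using sublinear_scale[OF assms(1), of "- t"] by simp
      then show ?thesis using neg[of "t *\<^sub>R x"] by simp
    qed
  qed
qed

text \<open>
  A sublinear functional stands for the convex set of the linear functionals below it;
  the following says that the set given by \<open>r\<close> is a face of the one given by \<open>s\<close>.
\<close>

definition sublinear_face :: "('a::real_vector \<Rightarrow> real) \<Rightarrow> ('a \<Rightarrow> real) \<Rightarrow> bool" where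
  "sublinear_face r s \<longleftrightarrow> sublinear r \<and> r \<le> s \<and>
     (\<forall>f g u. linear f \<and> linear g \<and> f \<le> s \<and> g \<le> s \<and> 0 < u \<and> u < 1 \<and>
        (\<lambda>x. (1 - u) * f x + u * g x) \<le> r \<longrightarrow> f \<le> r \<and> g \<le> r)"

lemma sublinear_face_sublinear: "sublinear_face r s \<Longrightarrow> sublinear r"
  unfolding sublinear_face_def by (rule conjunct1)

lemma sublinear_face_le: "sublinear_face r s \<Longrightarrow> r \<le> s"
  unfolding sublinear_face_def by (drule conjunct2) (rule conjunct1)

lemma sublinear_faceD:
  assumes "sublinear_face r s" "linear f" "linear g" "f \<le> s" "g \<le> s" "0 < u" "u < 1"
    and "\<And>x. (1 - u) * f x + u * g x \<le> r x"
  shows "f \<le> r" "g \<le> r"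
proof -
  have "(\<lambda>x. (1 - u) * f x + u * g x) \<le> r" using assms(8) by (rule le_funI)
  then have "f \<le> r \<and> g \<le> r"
    using assms(1)[unfolded sublinear_face_def, THEN conjunct2, THEN conjunct2, rule_format, of f g u]
      assms(2-7) by simp
  then show "f \<le> r" "g \<le> r" by auto
qed

lemma sublinear_faceI:
  assumes "sublinear r" "r \<le> s"
    and "\<And>f g u. linear f \<Longrightarrow> linear g \<Longrightarrow> f \<le> s \<Longrightarrow> g \<le> s \<Longrightarrow> 0 < u \<Longrightarrow> u < 1 \<Longrightarrow>
      (\<And>x. (1 - u) * f x + u * g x \<le> r x) \<Longrightarrow> f \<le> r \<and> g \<le> r"
  shows "sublinear_face r s"
  unfolding sublinear_face_def
proof (intro conjI[OF assms(1)] conjI[OF assms(2)] allI impI)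
  fix f g u
  assume h: "linear f \<and> linear g \<and> f \<le> s \<and> g \<le> s \<and> 0 < u \<and> u < 1 \<and>
    (\<lambda>x. (1 - u) * f x + u * g x) \<le> r"
  have "(1 - u) * f x + u * g x \<le> r x" for x
    using h le_funD[of "\<lambda>x. (1 - u) * f x + u * g x" r x] by simp
  then show "f \<le> r \<and> g \<le> r" using h by (intro assms(3)[of f g u]) simp_all
qed

text \<open>The functionals \<open>f\<close> and \<open>g\<close> are pushed first below
  \<open>s\<close>, then below \<open>r\<close>. This lets a face of a face compete in the
  minimality argument of \<open>extreme_Hahn_Banach\<close>.\<close>

lemma sublinear_face_trans:
  assumes "sublinear_face r s" "sublinear_face s t" shows "sublinear_face r t"
proof -
  note rst = sublinear_face_le[OF assms(1)] sublinear_face_le[OF assms(2)]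
    sublinear_face_sublinear[OF assms(1)]
  show ?thesis
  proof (rule sublinear_faceI[OF rst(3) order_trans[OF rst(1,2)]])
    fix f g u
    assume h: "linear f" "linear g" "f \<le> t" "g \<le> t" "0 < u" "u < 1"
      and r: "\<And>x. (1 - u) * f x + u * g x \<le> r x"
    have "(1 - u) * f x + u * g x \<le> s x" for x
      using r[of x] le_funD[OF rst(1), of x] by linarith
    note st = sublinear_faceD[OF assms(2) h this]
    show "f \<le> r \<and> g \<le> r"
      by (intro conjI sublinear_faceD[OF assms(1) h(1,2) st h(5,6) r])
  qed
qed

text \<open>Linear functionals below \<open>s\<close> are at most \<open>c\<close> on
  \<open>A\<close>, so those equal to \<open>c\<close> on all of \<open>A\<close> form a face, and
  \<open>r\<close> is its support function. The conclusion \<open>r (- a) \<le> - c\<close> forces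
  \<open>f a \<ge> c\<close> for every linear \<open>f\<close> below \<open>r\<close>.\<close>

lemma sublinear_face_exposed:
  assumes s: "sublinear s" and A: "convex A" "A \<noteq> {}" and c: "\<And>a. a \<in> A \<Longrightarrow> s a = c"
  obtains r where "sublinear_face r s" "\<And>a. a \<in> A \<Longrightarrow> r (- a) \<le> - c"
proof -
  define I where "I = {0::real..} \<times> A"
  \<comment> \<open>A linear \<open>f \<le> s\<close> with \<open>f a = c\<close> satisfies
    \<open>f x = f (x + t *\<^sub>R a) - t * c\<close>, hence
    \<open>f x \<le> v x (t, a)\<close>.\<close>
  define v where "v x = (\<lambda>(t, a). s (x + t *\<^sub>R a) - t * c)" for x
  define r where "r x = (INF i\<in>I. v x i)" for x
  have I: "I \<noteq> {}" using A by (auto simp: I_def)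
  \<comment> \<open>A bound uniform in \<open>i\<close>, so that \<open>r x\<close> is a genuine
    infimum.\<close>
  have lower: "- s (- x) \<le> v x i" if i_in: "i \<in> I" for x i
  proof -
    obtain t a where i: "i = (t, a)" "t \<ge> 0" "a \<in> A" using i_in by (auto simp: I_def)
    have "t * c = s (t *\<^sub>R a)" using i c sublinear_scale[OF s] by simp
    also have "\<dots> \<le> s (x + t *\<^sub>R a) + s (- x)"
      using sublinear_add[OF s, of "x + t *\<^sub>R a" "- x"] by simp
    finally show ?thesis by (simp add: v_def i)
  qed
  have bdd: "bdd_below (v x ` I)" for x using lower by (meson bdd_belowI2)
  have r_le: "r x \<le> s (x + t *\<^sub>R a) - t * c" if "0 \<le> t" "a \<in> A" for x t a
    using cINF_lower[OF bdd, of "(t, a)" x] that by (simp add: r_def I_def v_def)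
  have r_ge: "k \<le> r x" if "\<And>t a. 0 \<le> t \<Longrightarrow> a \<in> A \<Longrightarrow> k \<le> s (x + t *\<^sub>R a) - t * c" for k x
    unfolding r_def using that by (intro cINF_greatest[OF I]) (auto simp: I_def v_def)
  obtain a0 where a0: "a0 \<in> A" using A by blast
  have "r \<le> s" using r_le[OF order_refl a0] by (simp add: le_fun_def)
  have "sublinear r"
    unfolding sublinear_def
  proof (intro conjI allI impI)
    fix x y
    have *: "r (x + y) \<le> (s (x + t *\<^sub>R a) - t * c) + (s (y + u *\<^sub>R b) - u * c)"
      if tu: "0 \<le> t" "a \<in> A" "0 \<le> u" "b \<in> A" for t u :: real and a b
    proof -
      \<comment> \<open>Convexity of \<open>A\<close> merges the two directions into a single one;
        if both coefficients vanish, any point of \<open>A\<close> serves.\<close>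
      obtain d where d: "d \<in> A" "(t + u) *\<^sub>R d = t *\<^sub>R a + u *\<^sub>R b"
      proof (cases "t + u = 0")
        case True
        then have "t = 0" "u = 0" using tu by auto
        then show ?thesis using that[OF a0] by simp
      next
        case False
        then have "t + u > 0" using tu by simp
        have "(t / (t + u)) *\<^sub>R a + (u / (t + u)) *\<^sub>R b \<in> A"
          using tu False \<open>t + u > 0\<close> by (intro convexD[OF A(1)]) (auto simp: add_divide_distrib[symmetric])
        then show ?thesis by (rule that(1)) (use False in \<open>simp add: scaleR_add_right\<close>)
      qed
      have "r (x + y) \<le> s (x + y + (t + u) *\<^sub>R d) - (t + u) * c"
        by (rule r_le) (use tu d in auto)
      also have "x + y + (t + u) *\<^sub>R d = (x + t *\<^sub>R a) + (y + u *\<^sub>R b)"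
        using d by (simp add: algebra_simps)
      also have "s \<dots> \<le> s (x + t *\<^sub>R a) + s (y + u *\<^sub>R b)" by (rule sublinear_add[OF s])
      finally show ?thesis by (simp add: algebra_simps)
    qed
    have "r (x + y) - r x \<le> r y"
    proof (rule r_ge)
      fix b and u :: real assume ub: "0 \<le> u" "b \<in> A"
      have "r (x + y) - (s (y + u *\<^sub>R b) - u * c) \<le> r x"
        by (rule r_ge) (use *[OF _ _ ub] in \<open>simp add: algebra_simps\<close>)
      then show "r (x + y) - r x \<le> s (y + u *\<^sub>R b) - u * c" by simp
    qed
    then show "r (x + y) \<le> r x + r y" by simp
  next
    fix t :: real and x assume t: "0 < t"
    have "r (t *\<^sub>R x) / t \<le> r x"
    proof (rule r_ge)
      fix a and u :: real assume ua: "0 \<le> u" "a \<in> A"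
      have "r (t *\<^sub>R x) \<le> s (t *\<^sub>R x + (t * u) *\<^sub>R a) - t * u * c"
        by (rule r_le) (use ua t in auto)
      also have "t *\<^sub>R x + (t * u) *\<^sub>R a = t *\<^sub>R (x + u *\<^sub>R a)" by (simp add: algebra_simps)
      also have "s \<dots> = t * s (x + u *\<^sub>R a)" using t by (intro sublinear_scale[OF s]) simp
      finally show "r (t *\<^sub>R x) / t \<le> s (x + u *\<^sub>R a) - u * c"
        using t by (simp add: field_simps)
    qed
    then show "r (t *\<^sub>R x) \<le> t * r x" using t by (simp add: field_simps)
  qed
  have neg: "r (- a) \<le> - c" if "a \<in> A" for a
    using r_le[of 1 a "- a"] that sublinear_zero[OF s] by simp
  have "sublinear_face r s"
  proof (rule sublinear_faceI[OF \<open>sublinear r\<close> \<open>r \<le> s\<close>])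
    fix f g u
    assume h: "linear f" "linear g" "f \<le> s" "g \<le> s" "0 < u" "u < 1"
      and mix: "\<And>x. (1 - u) * f x + u * g x \<le> r x"
    have le: "f \<le> r" if f: "linear f" "f \<le> s" "\<And>a. a \<in> A \<Longrightarrow> f a = c" for f
    proof (intro le_funI r_ge)
      fix x a and t :: real assume "0 \<le> t" "a \<in> A"
      have "f x = f (x + t *\<^sub>R a) - t * c"
        using f(3)[OF \<open>a \<in> A\<close>] by (simp add: linear_add[OF f(1)] linear_cmul[OF f(1)])
      then show "f x \<le> s (x + t *\<^sub>R a) - t * c" using le_funD[OF f(2), of "x + t *\<^sub>R a"] by simp
    qed
    \<comment> \<open>A convex combination, with positive weights, of two numbers at most
      \<open>c\<close> reaches \<open>c\<close> only if both do.\<close>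
    have eq: "f a = c \<and> g a = c" if "a \<in> A" for a
    proof -
      have "c \<le> (1 - u) * f a + u * g a"
        using order_trans[OF mix neg[OF that]] h by (simp add: linear_neg)
      then have "(1 - u) * (c - f a) + u * (c - g a) \<le> 0" by (simp add: algebra_simps)
      moreover have "f a \<le> c" "g a \<le> c"
        using le_funD[OF h(3), of a] le_funD[OF h(4), of a] c[OF that] by simp_all
      then have "(1 - u) * (c - f a) \<ge> 0" "u * (c - g a) \<ge> 0" using h by simp_all
      ultimately have "(1 - u) * (c - f a) = 0" "u * (c - g a) = 0" by linarith+
      then show ?thesis using h by simp
    qed
    show "f \<le> r \<and> g \<le> r" using le[OF h(1,3)] le[OF h(2,4)] eq by simp
  qed
  then show thesis using neg by (rule that)
qed

text \<open>The pointwise infimum is the lower bound needed for Zorn's lemma. It stays subadditive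
  because two members of a chain can both be replaced by the smaller one.\<close>

lemma sublinear_face_chain:
  assumes C: "C \<noteq> {}" "\<And>r. r \<in> C \<Longrightarrow> sublinear_face r s"
    and chain: "\<And>r t. r \<in> C \<Longrightarrow> t \<in> C \<Longrightarrow> r \<le> t \<or> t \<le> r"
  obtains m where "sublinear_face m s" "\<And>r. r \<in> C \<Longrightarrow> m \<le> r"
proof -
  define m where "m x = (INF r\<in>C. r x)" for x
  have sub: "sublinear r" "r \<le> s" if "r \<in> C" for r using sublinear_face_sublinear sublinear_face_le C(2)[OF that] by blast+
  have "- s (- x) \<le> r x" if "r \<in> C" for r x
    using sublinear_minus[OF sub(1)[OF that], of x] le_funD[OF sub(2)[OF that], of "- x"] by simp
  then have bdd: "bdd_below ((\<lambda>r. r x) ` C)" for x by (meson bdd_belowI2)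
  have m_le: "m x \<le> r x" if "r \<in> C" for r x
    using cINF_lower[OF bdd that] by (simp add: m_def)
  have m_ge: "k \<le> m x" if "\<And>r. r \<in> C \<Longrightarrow> k \<le> r x" for k x
    unfolding m_def using that by (intro cINF_greatest[OF C(1)])
  have "sublinear m"
    unfolding sublinear_def
  proof (intro conjI allI impI)
    fix x y
    have *: "m (x + y) \<le> r x + t y" if rt: "r \<in> C" "t \<in> C" for r t
    proof -
      obtain w where w: "w \<in> C" "w \<le> r" "w \<le> t" using chain[OF rt] rt by blast
      have "m (x + y) \<le> w (x + y)" by (rule m_le[OF w(1)])
      also have "\<dots> \<le> w x + w y" by (rule sublinear_add[OF sub(1)[OF w(1)]])
      also have "\<dots> \<le> r x + t y" using w by (auto simp: le_fun_def intro: add_mono)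
      finally show ?thesis .
    qed
    have "m (x + y) - m x \<le> m y"
    proof (rule m_ge)
      fix t assume t: "t \<in> C"
      have "m (x + y) - t y \<le> m x" by (rule m_ge) (use *[OF _ t] in \<open>simp add: algebra_simps\<close>)
      then show "m (x + y) - m x \<le> t y" by simp
    qed
    then show "m (x + y) \<le> m x + m y" by simp
  next
    fix t :: real and x assume t: "0 < t"
    have "m (t *\<^sub>R x) / t \<le> m x"
    proof (rule m_ge)
      fix r assume "r \<in> C"
      then show "m (t *\<^sub>R x) / t \<le> r x"
        using m_le[of r "t *\<^sub>R x"] sublinear_scale[OF sub(1), of r t x] t by (simp add: field_simps)
    qed
    then show "m (t *\<^sub>R x) \<le> t * m x" using t by (simp add: field_simps)
  qed
  moreover obtain t where "t \<in> C" using C(1) by blast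
  then have "m \<le> s" using m_le[OF \<open>t \<in> C\<close>] le_funD[OF sub(2)[OF \<open>t \<in> C\<close>]]
    by (intro le_funI) (blast intro: order_trans)
  ultimately have "sublinear_face m s"
  proof (rule sublinear_faceI)
    fix f g u
    assume h: "linear f" "linear g" "f \<le> s" "g \<le> s" "0 < u" "u < 1"
      and mix: "\<And>x. (1 - u) * f x + u * g x \<le> m x"
    have "f \<le> r \<and> g \<le> r" if "r \<in> C" for r
      using sublinear_faceD[OF C(2)[OF that] h order_trans[OF mix m_le[OF that]]] by simp
    then show "f \<le> m \<and> g \<le> m" by (simp add: le_fun_def m_ge)
  qed
  then show thesis using m_le by (intro that) (auto simp: le_fun_def)
qed

text \<open>A linear \<open>f\<close> that is a face of \<open>s\<close> is an extreme point among
  the linear functionals below \<open>s\<close>. Zorn's lemma gives a minimal face below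
  \<open>r\<close>, and a face that is not linear could be cut down further.\<close>

theorem extreme_Hahn_Banach:
  assumes "sublinear_face r s"
  obtains f where "linear f" "f \<le> r" "sublinear_face f s"
proof -
  define A where "A = {t. sublinear_face t s \<and> t \<le> r}"
  define R where "R = relation_of (\<lambda>t u. u \<le> t) A"
  have "\<exists>m\<in>A. \<forall>a\<in>A. a \<le> m \<longrightarrow> a = m"
  proof (rule predicate_Zorn)
    show "partial_order_on A (relation_of (\<lambda>t u. u \<le> t) A)"
      by (rule partial_order_on_relation_ofI) auto
    fix C assume C: "C \<in> Chains (relation_of (\<lambda>t u. u \<le> t) A)"
    then have CA: "C \<subseteq> A" by (auto simp: Chains_def relation_of_def)
    show "\<exists>u\<in>A. \<forall>a\<in>C. u \<le> a"
    proof (cases "C = {}")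
      case True
      then show ?thesis using assms by (auto simp: A_def)
    next
      case False
      obtain m where m: "sublinear_face m s" "\<And>t. t \<in> C \<Longrightarrow> m \<le> t"
      proof (rule sublinear_face_chain[OF False])
        show "\<And>t. t \<in> C \<Longrightarrow> sublinear_face t s" using CA by (auto simp: A_def)
        show "\<And>t u. t \<in> C \<Longrightarrow> u \<in> C \<Longrightarrow> t \<le> u \<or> u \<le> t" using C by (auto simp: Chains_def relation_of_def)
      qed auto
      moreover have "m \<le> r" using False CA m(2) by (force simp: A_def intro: order_trans)
      ultimately show ?thesis by (auto simp: A_def)
    qed
  qed
  then obtain m where m: "m \<in> A" and min: "\<And>t. t \<in> A \<Longrightarrow> t \<le> m \<Longrightarrow> t = m" by blast
  have mf: "sublinear_face m s" "m \<le> r" using m by (auto simp: A_def)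
  then have sm: "sublinear m" using sublinear_face_sublinear by blast
  \<comment> \<open>Exposing \<open>{y}\<close> within \<open>m\<close> yields a face of
    \<open>s\<close> below \<open>m\<close>, which by minimality is \<open>m\<close> itself.\<close>
  have "m (- y) \<le> - m y" for y
  proof -
    obtain t where t: "sublinear_face t m" "t (- y) \<le> - m y"
      by (rule sublinear_face_exposed[OF sm, of "{y}" "m y"]) auto
    have "t \<le> m" using t sublinear_face_le by blast
    moreover have "t \<in> A" using sublinear_face_trans[OF t(1) mf(1)] \<open>t \<le> m\<close> mf by (auto simp: A_def)
    ultimately have "t = m" using min by blast
    then show ?thesis using t by simp
  qed
  then show thesis using sublinear_linear[OF sm] mf that by blast
qed


section \<open>Maximal convex subsets of the sphere\<close>

lemma scaleC_one [simp]: "1 *\<^sub>C (x::'a::complex_banach) = x"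
  using scaleC_of_real[of 1 x] by simp

lemma scaleC_scaleR: "c *\<^sub>C (r *\<^sub>R x) = r *\<^sub>R (c *\<^sub>C (x::'a::complex_banach))"
proof -
  have "c *\<^sub>C (complex_of_real r *\<^sub>C x) = complex_of_real r *\<^sub>C (c *\<^sub>C x)"
    by (simp only: scaleC_scaleC mult.commute)
  then show ?thesis by (simp only: scaleC_of_real)
qed

lemma linear_scaleC: "linear ((*\<^sub>C) c :: 'a \<Rightarrow> 'a::complex_banach)"
  by (rule linearI) (simp_all add: scaleC_add_right scaleC_scaleR)

lemma dual_unit_ballD:
  assumes "p \<in> dual_unit_ball"
  shows "blinfun_apply p (c *\<^sub>C a) = c * blinfun_apply p a" "cmod (blinfun_apply p a) \<le> norm a"
proof -
  show "blinfun_apply p (c *\<^sub>C a) = c * blinfun_apply p a"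
    using assms by (simp add: dual_unit_ball_def complex_dual_def)
  have "norm p * norm a \<le> 1 * norm a"
    using assms by (intro mult_right_mono) (auto simp: dual_unit_ball_def)
  then show "cmod (blinfun_apply p a) \<le> norm a" using norm_blinfun[of p a] by simp
qed

lemma dual_unit_ball_Re_le: "p \<in> dual_unit_ball \<Longrightarrow> Re (blinfun_apply p a) \<le> norm a"
  using dual_unit_ballD(2)[of p a] complex_Re_le_cmod order_trans by blast

lemma linear_Re_blinfun: "linear (\<lambda>a. Re (blinfun_apply p a))"
  by (rule linearI) (simp_all add: blinfun.add_right blinfun.scaleR_right)

text \<open>By complex linearity the imaginary part at \<open>a\<close> is the negative of the real
  part at \<open>\<i> *\<^sub>C a\<close>.\<close>

lemma dual_unit_ball_eqI:
  assumes "p \<in> dual_unit_ball" "q \<in> dual_unit_ball"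
    and "\<And>a. Re (blinfun_apply p a) = Re (blinfun_apply q a)"
  shows "p = q"
proof (rule blinfun_eqI)
  fix a
  have "Re (blinfun_apply p (\<i> *\<^sub>C a)) = Re (blinfun_apply q (\<i> *\<^sub>C a))" by (rule assms)
  then show "blinfun_apply p a = blinfun_apply q a"
    using assms by (simp add: dual_unit_ballD complex_eq_iff)
qed

lemma complexify_functional:
  fixes f :: "'a::complex_banach \<Rightarrow> real"
  assumes f: "linear f" "f \<le> norm"
  obtains p where "p \<in> dual_unit_ball" "\<And>x. Re (blinfun_apply p x) = f x"
proof -
  \<comment> \<open>Complex linearity leaves no other choice for the imaginary part.\<close>
  define g where "g x = Complex (f x) (- f (\<i> *\<^sub>C x))" for x
  have add: "g (x + y) = g x + g y" for x y
    by (simp add: g_def complex_eq_iff linear_add[OF f(1)] scaleC_add_right)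
  have sc: "g (c *\<^sub>C x) = c * g x" for c x
  proof -
    have 1: "f (c *\<^sub>C x) = Re c * f x + Im c * f (\<i> *\<^sub>C x)" for c x
    proof -
      have "c *\<^sub>C x = (complex_of_real (Re c) + complex_of_real (Im c) * \<i>) *\<^sub>C x"
        by (simp add: complex_eq[symmetric] mult.commute)
      also have "\<dots> = Re c *\<^sub>R x + Im c *\<^sub>R (\<i> *\<^sub>C x)"
        by (simp only: scaleC_add_left scaleC_scaleC[symmetric] scaleC_of_real)
      finally show ?thesis by (simp add: linear_add[OF f(1)] linear_cmul[OF f(1)])
    qed
    show ?thesis
      using 1[of c x] 1[of "\<i> * c" x] by (simp add: g_def complex_eq_iff scaleC_scaleC algebra_simps)
  qed
  have le: "cmod (g x) \<le> norm x" for x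
  proof (cases "g x = 0")
    case False
    \<comment> \<open>The rotation \<open>c\<close> moves \<open>g x\<close> to the positive real
      axis, so \<open>cmod (g x)\<close> becomes \<open>f (c *\<^sub>C x)\<close>, which is at most
      \<open>norm x\<close>.\<close>
    define c where "c = cnj (sgn (g x))"
    have c: "cmod c = 1" using False by (simp add: c_def norm_sgn)
    have "c * sgn (g x) = 1"
      using False complex_norm_square[of "sgn (g x)"] by (simp add: c_def norm_sgn mult.commute)
    moreover have "g x = complex_of_real (cmod (g x)) * sgn (g x)"
      using False by (simp add: sgn_div_norm scaleR_conv_of_real)
    ultimately have "c * g x = complex_of_real (cmod (g x))" by (metis mult.left_commute mult.right_neutral)
    then have "g (c *\<^sub>C x) = complex_of_real (cmod (g x))" by (simp add: sc)
    then have "f (c *\<^sub>C x) = cmod (g x)" by (simp add: g_def complex_eq_iff)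
    then show ?thesis using le_funD[OF f(2), of "c *\<^sub>C x"] c by (simp add: norm_scaleC)
  qed simp
  have bl: "bounded_linear g"
  proof (rule bounded_linear_intro[of g 1])
    show "g (r *\<^sub>R x) = r *\<^sub>R g x" for r x
      using sc[of "complex_of_real r" x] by (simp add: scaleC_of_real scaleR_conv_of_real)
  qed (use add le in auto)
  define p where "p = Blinfun g"
  have p: "blinfun_apply p = g" using bl by (simp add: p_def bounded_linear_Blinfun_apply)
  have "norm p \<le> 1" by (rule norm_blinfun_bound) (use le p in auto)
  then have "p \<in> dual_unit_ball" using sc p by (simp add: dual_unit_ball_def complex_dual_def)
  moreover have "Re (blinfun_apply p x) = f x" for x by (simp add: p g_def)
  ultimately show thesis by (rule that)
qed

text \<open>Extremality passes from real to complex functionals: a real part lying below that of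
  \<open>p\<close> equals it, by evaluation at \<open>x\<close> and \<open>- x\<close>, and real
  parts determine the elements of the ball.\<close>

lemma extreme_point_of_dual_unit_ball:
  assumes p: "p \<in> dual_unit_ball" and face: "sublinear_face (\<lambda>x. Re (blinfun_apply p x)) norm"
  shows "p extreme_point_of dual_unit_ball"
  unfolding extreme_point_of_def
proof (intro conjI ballI notI)
  fix g h assume gh: "g \<in> dual_unit_ball" "h \<in> dual_unit_ball" "p \<in> open_segment g h"
  then obtain u where u: "g \<noteq> h" "0 < u" "u < 1" "p = (1 - u) *\<^sub>R g + u *\<^sub>R h"
    by (auto simp: in_segment)
  have le: "(\<lambda>x. Re (blinfun_apply k x)) \<le> norm" if "k \<in> dual_unit_ball" for k
    using dual_unit_ball_Re_le[OF that] by (rule le_funI)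
  have "(1 - u) * Re (blinfun_apply g x) + u * Re (blinfun_apply h x) \<le> Re (blinfun_apply p x)" for x
    by (simp add: u(4) blinfun.add_left blinfun.scaleR_left)
  note below = sublinear_faceD[OF face linear_Re_blinfun linear_Re_blinfun le[OF gh(1)] le[OF gh(2)]
      u(2,3) this]
  have eq: "k = p" if k: "k \<in> dual_unit_ball"
    "(\<lambda>x. Re (blinfun_apply k x)) \<le> (\<lambda>x. Re (blinfun_apply p x))" for k
  proof (rule dual_unit_ball_eqI[OF k(1) p])
    fix x
    show "Re (blinfun_apply k x) = Re (blinfun_apply p x)"
      using le_funD[OF k(2), of x] le_funD[OF k(2), of "- x"] by (simp add: blinfun.minus_right)
  qed
  show False using eq[OF gh(1) below(1)] eq[OF gh(2) below(2)] u(1) by simp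
qed (rule p)

lemma sublinear_norm: "sublinear norm"
  by (simp add: sublinear_def norm_triangle_ineq)

lemma Fset_one: "Fset p 1 = face (blinfun_apply p)"
  by (auto simp: Fset_def face_def)

lemma convex_face:
  assumes p: "p \<in> dual_unit_ball" shows "convex (face (blinfun_apply p))"
proof (rule convexI)
  fix x y and u v :: real
  assume h: "x \<in> face (blinfun_apply p)" "y \<in> face (blinfun_apply p)" "0 \<le> u" "0 \<le> v" "u + v = 1"
  have "blinfun_apply p (u *\<^sub>R x + v *\<^sub>R y) = complex_of_real (u + v)"
    using h(1,2) by (simp add: face_def blinfun.add_right blinfun.scaleR_right scaleR_conv_of_real)
  then have *: "blinfun_apply p (u *\<^sub>R x + v *\<^sub>R y) = 1" using h by simp
  have "norm (u *\<^sub>R x + v *\<^sub>R y) \<ge> 1" using dual_unit_ballD(2)[OF p, of "u *\<^sub>R x + v *\<^sub>R y"] * by simp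
  moreover have "norm (u *\<^sub>R x + v *\<^sub>R y) \<le> u * norm x + v * norm y"
    using norm_triangle_ineq[of "u *\<^sub>R x" "v *\<^sub>R y"] h by simp
  ultimately show "u *\<^sub>R x + v *\<^sub>R y \<in> face (blinfun_apply p)" using * h by (simp add: face_def)
qed

text \<open>The norm is constantly 1 on the convex set \<open>F\<close>, so \<open>F\<close> exposes
  a face of the norm. An extreme functional below that face has real part at least 1 on
  \<open>F\<close>, and in the closed unit disc this forces the value 1.\<close>

lemma extreme_support_functional:
  fixes F :: "'a::complex_banach set"
  assumes "convex F" "F \<subseteq> sphere 0 1" "F \<noteq> {}"
  obtains p where "p extreme_point_of dual_unit_ball" "F \<subseteq> face (blinfun_apply p)"
proof -
  have "\<And>a. a \<in> F \<Longrightarrow> norm a = 1" using assms(2) by auto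
  then obtain r where r: "sublinear_face r norm" "\<And>a. a \<in> F \<Longrightarrow> r (- a) \<le> - 1"
    using sublinear_face_exposed[OF sublinear_norm assms(1,3)] by blast
  obtain f where f: "linear f" "f \<le> r" "sublinear_face f norm" using extreme_Hahn_Banach[OF r(1)] .
  obtain p where p: "p \<in> dual_unit_ball" "\<And>x. Re (blinfun_apply p x) = f x"
    by (rule complexify_functional[OF f(1) sublinear_face_le[OF f(3)]]) blast
  have "(\<lambda>x. Re (blinfun_apply p x)) = f" using p(2) by (rule ext)
  then have "p extreme_point_of dual_unit_ball"
    using extreme_point_of_dual_unit_ball[OF p(1)] f(3) by simp
  moreover have "a \<in> face (blinfun_apply p)" if "a \<in> F" for a
  proof -
    have a: "norm a = 1" using assms(2) that by auto
    have "f (- a) \<le> - 1" using le_funD[OF f(2), of "- a"] r(2)[OF that] by simp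
    then have "1 \<le> Re (blinfun_apply p a)" by (simp add: p(2) linear_neg[OF f(1)])
    moreover have "cmod (blinfun_apply p a) \<le> 1" using dual_unit_ballD(2)[OF p(1), of a] a by simp
    ultimately have "Re (blinfun_apply p a) = cmod (blinfun_apply p a)" "cmod (blinfun_apply p a) = 1"
      using complex_Re_le_cmod[of "blinfun_apply p a"] by linarith+
    then have "blinfun_apply p a = 1"
      using cmod_power2[of "blinfun_apply p a"] by (simp add: complex_eq_iff)
    then show ?thesis using a by (simp add: face_def)
  qed
  ultimately show thesis by (intro that) auto
qed

section \<open>Existence and metric description of maximal convex sets\<close>

lemma max_convexD:
  assumes "F \<in> max_convex_subsets"
  shows "F \<subseteq> sphere 0 1" "convex F" "\<And>G. G \<subseteq> sphere 0 1 \<Longrightarrow> convex G \<Longrightarrow> F \<subseteq> G \<Longrightarrow> G = F"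
  using assms by (auto simp: max_convex_subsets_def)

text \<open>The face of a supporting extreme functional is convex and contains \<open>F\<close>, so
  maximality of \<open>F\<close> gives equality.\<close>

lemma max_convex_subsets_imp_face:
  assumes F: "F \<in> max_convex_subsets" "F \<noteq> {}"
  obtains p where "p \<in> Qset" "face (blinfun_apply p) = F"
proof -
  obtain p where p: "p extreme_point_of dual_unit_ball" "F \<subseteq> face (blinfun_apply p)"
    using extreme_support_functional[OF max_convexD(2,1)[OF F(1)] F(2)] .
  have "p \<in> dual_unit_ball" using p(1) by (simp add: extreme_point_of_def)
  then have "face (blinfun_apply p) = F"
    by (intro max_convexD(3)[OF F(1)] convex_face p) (auto simp: face_def)
  then show thesis using p F by (intro that[of p]) (simp_all add: Qset_def)
qed

lemma Qset_dual_unit_ball: "p \<in> Qset \<Longrightarrow> p \<in> dual_unit_ball"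
  by (simp add: Qset_def extreme_point_of_def)

lemma max_convex_superset:
  assumes "convex G" "G \<subseteq> sphere 0 1"
  obtains F where "F \<in> max_convex_subsets" "G \<subseteq> F"
proof -
  let ?A = "{H. G \<subseteq> H \<and> convex H \<and> H \<subseteq> sphere 0 1}"
  have "\<exists>M\<in>?A. \<forall>X\<in>?A. M \<subseteq> X \<longrightarrow> X = M"
  proof (rule subset_Zorn_nonempty)
    show "?A \<noteq> {}" using assms by blast
    fix C assume C: "C \<noteq> {}" "subset.chain ?A C"
    have "convex (\<Union>C)"
    proof (rule convexI)
      fix x y and u v :: real assume xy: "x \<in> \<Union>C" "y \<in> \<Union>C" and uv: "0 \<le> u" "0 \<le> v" "u + v = 1"
      obtain X Y where XY: "X \<in> C" "x \<in> X" "Y \<in> C" "y \<in> Y" using xy by blast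
      then have "X \<subseteq> Y \<or> Y \<subseteq> X" using C(2) by (auto simp: subset_chain_def)
      then obtain Z where Z: "Z \<in> C" "x \<in> Z" "y \<in> Z" using XY by blast
      then have "convex Z" using C(2) by (auto simp: subset_chain_def)
      then show "u *\<^sub>R x + v *\<^sub>R y \<in> \<Union>C" using convexD[OF _ Z(2,3) uv] Z(1) by blast
    qed
    then show "\<Union>C \<in> ?A" using C by (auto simp: subset_chain_def)
  qed
  then obtain M where M: "M \<in> ?A" and max: "\<forall>X\<in>?A. M \<subseteq> X \<longrightarrow> X = M" by (rule bexE)
  have "M \<in> max_convex_subsets"
    unfolding max_convex_subsets_def
  proof (intro CollectI conjI allI impI)
    fix X assume "X \<subseteq> sphere 0 1 \<and> convex X \<and> M \<subseteq> X"
    then show "X = M" using M max[THEN bspec, of X] by auto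
  qed (use M in auto)
  then show thesis using M by (intro that[of M]) simp_all
qed

lemma max_convex_scaleC:
  assumes F: "F \<in> max_convex_subsets" and c: "cmod c = 1"
  shows "(*\<^sub>C) c ` F \<in> max_convex_subsets"
proof -
  have inv: "cnj c * c = 1" using c by (simp add: mult.commute complex_norm_square[symmetric])
  have sph: "(*\<^sub>C) d ` G \<subseteq> sphere 0 1" if "G \<subseteq> sphere 0 1" "cmod d = 1" for d and G :: "'a set"
    using that by (auto simp: norm_scaleC)
  have id1: "(*\<^sub>C) (cnj c) ` (*\<^sub>C) c ` G = G" "(*\<^sub>C) c ` (*\<^sub>C) (cnj c) ` G = G" for G :: "'a set"
    using inv by (simp_all add: image_image scaleC_scaleC mult.commute)
  have "G = (*\<^sub>C) c ` F" if G: "G \<subseteq> sphere 0 1" "convex G" "(*\<^sub>C) c ` F \<subseteq> G" for G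
  proof -
    have "(*\<^sub>C) (cnj c) ` G = F"
    proof (rule max_convexD(3)[OF F])
      show "F \<subseteq> (*\<^sub>C) (cnj c) ` G" using image_mono[OF G(3)] id1(1)[of F] by metis
    qed (use sph[OF G(1), of "cnj c"] c convex_linear_image[OF linear_scaleC G(2)] in auto)
    then show ?thesis using id1(2)[of G] by simp
  qed
  then show ?thesis
    using sph[OF max_convexD(1)[OF F] c] convex_linear_image[OF linear_scaleC max_convexD(2)[OF F]]
    by (auto simp: max_convex_subsets_def)
qed

lemma norm_add_convex_sphere:
  assumes "convex F" "F \<subseteq> sphere 0 1" "x \<in> F" "y \<in> F"
  shows "norm (x + y) = 2"
proof -
  have "(1/2) *\<^sub>R x + (1/2) *\<^sub>R y \<in> F" using assms by (intro convexD) auto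
  then have "norm ((1/2) *\<^sub>R (x + y)) = 1" using assms(2) by (auto simp: scaleR_add_right)
  then show ?thesis by simp
qed

text \<open>If \<open>v\<close> is the larger weight, \<open>v *\<^sub>R (x + y)\<close> differs
  from the combination by \<open>(v - u) *\<^sub>R x\<close>, and the triangle inequality leaves at
  least \<open>2 * v - (v - u) = 1\<close> for the combination.\<close>

lemma norm_convex_combination_eq_1:
  assumes xy: "norm x = 1" "norm y = 1" "norm (x + y) = 2" and uv: "0 \<le> u" "0 \<le> v" "u + v = 1"
  shows "norm (u *\<^sub>R x + v *\<^sub>R y) = 1"
proof (rule antisym)
  show "norm (u *\<^sub>R x + v *\<^sub>R y) \<le> 1"
    using norm_triangle_ineq[of "u *\<^sub>R x" "v *\<^sub>R y"] xy uv by simp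
  have *: "1 \<le> norm (u *\<^sub>R x + v *\<^sub>R y)"
    if "norm x = 1" "norm y = 1" "norm (x + y) = 2" "0 \<le> u" "u \<le> v" "u + v = 1" for x y :: 'a and u v
  proof -
    have "v *\<^sub>R (x + y) = (u *\<^sub>R x + v *\<^sub>R y) + (v - u) *\<^sub>R x" by (simp add: algebra_simps)
    then have "v * 2 \<le> norm (u *\<^sub>R x + v *\<^sub>R y) + (v - u) * 1"
      using norm_triangle_ineq[of "u *\<^sub>R x + v *\<^sub>R y" "(v - u) *\<^sub>R x"] that
      by (metis abs_of_nonneg diff_ge_0_iff_ge norm_scaleR order_trans)
    then show ?thesis using that by simp
  qed
  show "1 \<le> norm (u *\<^sub>R x + v *\<^sub>R y)"
    using *[of x y u v] *[of y x v u] xy uv by (cases "u \<le> v") (simp_all add: add.commute)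
qed

text \<open>The segments from \<open>w\<close> to points of \<open>F\<close> stay in the sphere, so
  the hull of \<open>insert w F\<close> cannot exceed the maximal set \<open>F\<close>. Membership
  thereby becomes a condition on distances, which isometries respect.\<close>

lemma max_convex_memI:
  assumes F: "F \<in> max_convex_subsets" "F \<noteq> {}" and w: "norm w = 1" "\<And>v. v \<in> F \<Longrightarrow> norm (w + v) = 2"
  shows "w \<in> F"
proof -
  have "convex hull (insert w F) = F"
  proof (rule max_convexD(3)[OF F(1)])
    show "convex hull insert w F \<subseteq> sphere 0 1"
    proof
      fix x assume "x \<in> convex hull insert w F"
      then obtain u v b where "0 \<le> u" "0 \<le> v" "u + v = 1" "b \<in> F" "x = u *\<^sub>R w + v *\<^sub>R b"
        using F(2) convex_hull_insert[OF F(2), of w] hull_same[of convex F] max_convexD(2)[OF F(1)]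
        by auto
      then show "x \<in> sphere 0 1"
        using norm_convex_combination_eq_1[of w b u v] w max_convexD(1)[OF F(1)] by auto
    qed
  qed (auto simp: hull_inc)
  then show ?thesis by (metis hull_inc insertI1)
qed

text \<open>Every \<open>x + y\<close> has norm at most 2 and their weighted mean has norm 2. As all
  weights are positive, no term can fall short.\<close>

lemma norm_add_convex_sum:
  assumes S: "finite S" "x \<in> S" and u: "\<And>x. x \<in> S \<Longrightarrow> 0 < u x" "sum u S = 1"
    and n: "\<And>x. x \<in> S \<Longrightarrow> norm x = 1" "norm y = 1"
    and z: "norm ((\<Sum>x\<in>S. u x *\<^sub>R x) + y) = 2"
  shows "norm (x + y) = 2"
proof -
  have le2: "norm (x + y) \<le> 2" if "x \<in> S" for x
    using norm_triangle_ineq[of x y] n that by simp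
  have "(\<Sum>x\<in>S. u x *\<^sub>R x) + y = (\<Sum>x\<in>S. u x *\<^sub>R (x + y))"
    using u(2) by (simp add: scaleR_add_right sum.distrib flip: scaleR_sum_left)
  then have "2 \<le> (\<Sum>x\<in>S. norm (u x *\<^sub>R (x + y)))" using z norm_sum by metis
  also have "\<dots> = (\<Sum>x\<in>S. u x * norm (x + y))" using u(1) by (intro sum.cong) (auto simp: less_imp_le)
  also have "\<dots> = u x * norm (x + y) + (\<Sum>x\<in>S - {x}. u x * norm (x + y))"
    by (rule sum.remove[OF S])
  also have "(\<Sum>x\<in>S - {x}. u x * norm (x + y)) \<le> (\<Sum>x\<in>S - {x}. u x * 2)"
    using le2 u(1) by (intro sum_mono mult_left_mono) (auto simp: less_imp_le)
  also have "\<dots> = (1 - u x) * 2"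
    using u(2) sum.remove[OF S, of u] by (simp add: sum_distrib_right[symmetric])
  finally have "u x * 2 \<le> u x * norm (x + y)" by (simp add: algebra_simps)
  then have "2 \<le> norm (x + y)" using u(1)[OF S(2)] by simp
  then show ?thesis using le2[OF S(2)] by simp
qed

section \<open>Isometries of spheres\<close>

definition sphere_isometry :: "('a::real_normed_vector \<Rightarrow> 'b::real_normed_vector) \<Rightarrow> bool" where
  "sphere_isometry T \<longleftrightarrow> T ` sphere 0 1 = sphere 0 1 \<and>
     (\<forall>x \<in> sphere 0 1. \<forall>y \<in> sphere 0 1. dist (T x) (T y) = dist x y)"

lemma sphere_isometry_norm: "sphere_isometry T \<Longrightarrow> norm x = 1 \<Longrightarrow> norm (T x) = 1"
  unfolding sphere_isometry_def by (metis imageI mem_sphere_0)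

lemma sphere_isometry_dist:
  "sphere_isometry T \<Longrightarrow> norm x = 1 \<Longrightarrow> norm y = 1 \<Longrightarrow> dist (T x) (T y) = dist x y"
  by (simp add: sphere_isometry_def)

lemma sphere_isometry_inverse:
  fixes T :: "'a::real_normed_vector \<Rightarrow> 'b::real_normed_vector"
  assumes T: "sphere_isometry T"
  obtains k where "sphere_isometry k" "\<And>x. norm x = 1 \<Longrightarrow> k (T x) = x" "\<And>y. norm y = 1 \<Longrightarrow> T (k y) = y"
proof -
  let ?S = "sphere 0 1 :: 'a set"
  have inj: "inj_on T ?S"
    using sphere_isometry_dist[OF T] by (intro inj_onI) (metis dist_eq_0_iff mem_sphere_0)
  define k where "k = inv_into ?S T"
  have im: "T ` ?S = sphere 0 1" using T by (simp add: sphere_isometry_def)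
  have kT: "k (T x) = x" if "norm x = 1" for x using inv_into_f_f[OF inj] that by (simp add: k_def)
  have Tk: "T (k y) = y" if "norm y = 1" for y
    using f_inv_into_f[of y T ?S] im that by (simp add: k_def)
  have kn: "norm (k y) = 1" if "norm y = 1" for y
    using inv_into_into[of y T ?S] im that by (simp add: k_def)
  have "k ` sphere 0 1 = ?S"
  proof (intro equalityI subsetI)
    fix x assume "x \<in> ?S"
    then show "x \<in> k ` sphere 0 1"
      using kT[of x] sphere_isometry_norm[OF T, of x] by (intro image_eqI[of _ _ "T x"]) auto
  qed (use kn in auto)
  moreover have "dist (k x) (k y) = dist x y" if "norm x = 1" "norm y = 1" for x y
    using sphere_isometry_dist[OF T kn[OF that(1)] kn[OF that(2)]] Tk that by simp
  ultimately have "sphere_isometry k" by (simp add: sphere_isometry_def)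
  then show thesis using kT Tk by (rule that)
qed

lemma uminus_image_sphere: "uminus ` sphere 0 1 = (sphere 0 1 :: 'a::real_normed_vector set)"
proof (intro equalityI subsetI)
  fix x :: 'a assume "x \<in> sphere 0 1"
  then show "x \<in> uminus ` sphere 0 1" by (intro image_eqI[of _ _ "- x"]) auto
qed auto

lemma sphere_isometry_opposite:
  assumes "sphere_isometry T" shows "sphere_isometry (\<lambda>x. - T (- x))"
proof -
  have "(\<lambda>x. - T (- x)) ` sphere 0 1 = uminus ` T ` uminus ` sphere 0 1" by (simp add: image_image)
  also have "\<dots> = sphere 0 1" using assms by (simp only: uminus_image_sphere sphere_isometry_def)
  finally show ?thesis
    using sphere_isometry_dist[OF assms] by (simp add: sphere_isometry_def dist_minus)
qed

text \<open>
  An isometry need not be odd, so the star \<open>{y. norm (z + y) = 2}\<close>, which is the set of points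
  at distance 2 from \<open>- z\<close>, is carried to the star of \<open>- T (- z)\<close>. If \<open>z\<close> is the barycentre of
  points of \<open>C\<close>, its star is contained in theirs, and this inclusion is preserved.
\<close>

lemma convex_hull_opposite_image:
  fixes T :: "'a::complex_banach \<Rightarrow> 'b::complex_banach"
  assumes T: "sphere_isometry T" and C: "convex C" "C \<subseteq> sphere 0 1"
  shows "convex hull ((\<lambda>x. - T (- x)) ` C) \<subseteq> sphere 0 1"
proof
  let ?h = "\<lambda>x. - T (- x)"
  obtain k where k: "sphere_isometry k" "\<And>y. norm y = 1 \<Longrightarrow> T (k y) = y"
    by (rule sphere_isometry_inverse[OF T]) blast
  have star: "norm (?h z + T x) = 2 \<longleftrightarrow> norm (z + x) = 2" if "norm z = 1" "norm x = 1" for z x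
    using sphere_isometry_dist[OF T, of x "- z"] that by (simp add: dist_norm add.commute)
  have hn: "norm (?h x) = 1" if "norm x = 1" for x using sphere_isometry_norm[OF T, of "- x"] that by simp
  fix y assume "y \<in> convex hull (?h ` C)"
  then obtain S u where S: "finite S" "S \<subseteq> ?h ` C" "\<forall>x\<in>S. 0 \<le> u x" "sum u S = 1" "(\<Sum>v\<in>S. u v *\<^sub>R v) = y"
    unfolding convex_hull_explicit by blast
  obtain D where D: "D \<subseteq> C" "finite D" "S = ?h ` D" using finite_subset_image[OF S(1,2)] by blast
  have "D \<noteq> {}" using D(3) S(4) by auto
  \<comment> \<open>Equal weights are used instead of \<open>u\<close>, because
    \<open>norm_add_convex_sum\<close> needs positive weights and those of \<open>u\<close> may
    vanish.\<close>
  define z where "z = (\<Sum>x\<in>D. (1 / real (card D)) *\<^sub>R x)"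
  have cD: "card D > 0" using \<open>D \<noteq> {}\<close> D(2) by (simp add: card_gt_0_iff)
  have "z \<in> C" unfolding z_def using D C cD by (intro convex_sum) auto
  then have nz: "norm z = 1" using C by auto
  \<comment> \<open>Any maximal convex set through the image of the barycentre will contain the
    images of all points of \<open>D\<close>, hence also \<open>y\<close>.\<close>
  obtain F where F: "F \<in> max_convex_subsets" "{?h z} \<subseteq> F"
    by (rule max_convex_superset[of "{?h z}"]) (use hn[OF nz] in auto)
  have "?h x \<in> F" if "x \<in> D" for x
  proof (rule max_convex_memI[OF F(1)])
    show "F \<noteq> {}" using F by auto
    have nx: "norm x = 1" using that D C by auto
    show "norm (?h x) = 1" by (rule hn[OF nx])
    fix v assume v: "v \<in> F"
    have nv: "norm v = 1" using v max_convexD(1)[OF F(1)] by auto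
    have nk: "norm (k v) = 1" by (rule sphere_isometry_norm[OF k(1) nv])
    \<comment> \<open>The star relation is pulled back along \<open>T\<close>, passed from the
      barycentre \<open>z\<close> to \<open>x\<close>, and pushed forward again.\<close>
    have "norm (?h z + v) = 2"
      by (rule norm_add_convex_sphere[OF max_convexD(2,1)[OF F(1)]]) (use F(2) v in auto)
    then have "norm (z + k v) = 2" using star[OF nz nk] k(2)[OF nv] by simp
    then have "norm (x + k v) = 2"
      unfolding z_def
      by (rule norm_add_convex_sum[OF D(2) that _ _ _ nk, rotated -1]) (use cD D C in auto)
    then show "norm (?h x + v) = 2" using star[OF nx nk] k(2)[OF nv] by simp
  qed
  then have "S \<subseteq> F" using D by auto
  then have "y \<in> F"
    using S max_convexD(2)[OF F(1)] by (auto intro!: convex_sum)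
  then show "y \<in> sphere 0 1" using max_convexD(1)[OF F(1)] by auto
qed

text \<open>The image lies in a maximal convex \<open>D\<close>. The inverse map sends
  \<open>D\<close> to a set whose hull lies in the sphere and contains \<open>C\<close>, hence
  equals \<open>C\<close>; so the image fills \<open>D\<close>.\<close>

lemma opposite_image_max_convex:
  fixes T :: "'a::complex_banach \<Rightarrow> 'b::complex_banach"
  assumes T: "sphere_isometry T" and C: "C \<in> max_convex_subsets"
  shows "(\<lambda>x. - T (- x)) ` C \<in> max_convex_subsets"
proof -
  let ?h = "\<lambda>x. - T (- x)"
  obtain k where k: "sphere_isometry k" "\<And>x. norm x = 1 \<Longrightarrow> k (T x) = x" "\<And>y. norm y = 1 \<Longrightarrow> T (k y) = y"
    by (rule sphere_isometry_inverse[OF T]) (rule that)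
  let ?g = "\<lambda>x. - k (- x)"
  obtain D where D: "D \<in> max_convex_subsets" "convex hull (?h ` C) \<subseteq> D"
    using max_convex_superset[OF convex_convex_hull convex_hull_opposite_image[OF T max_convexD(2,1)[OF C]]] .
  have hD: "?h ` C \<subseteq> D" by (rule subset_trans[OF hull_subset D(2)])
  have gh: "?g (?h x) = x" if "norm x = 1" for x using k(2)[of "- x"] that by simp
  have hg: "?h (?g y) = y" if "norm y = 1" for y using k(3)[of "- y"] that by simp
  have "C \<subseteq> ?g ` D"
  proof
    fix x assume x: "x \<in> C"
    then have "?g (?h x) = x" using gh max_convexD(1)[OF C] by auto
    then show "x \<in> ?g ` D" using hD x by (intro image_eqI[of _ ?g "?h x"]) auto
  qed
  then have "convex hull (?g ` D) = C"
    by (intro max_convexD(3)[OF C] convex_hull_opposite_image[OF k(1) max_convexD(2,1)[OF D(1)]])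
      (auto intro: hull_inc)
  then have gD: "?g ` D \<subseteq> C" using hull_subset[of "?g ` D" convex] by simp
  have "D \<subseteq> ?h ` C"
  proof
    fix y assume y: "y \<in> D"
    then have "?h (?g y) = y" using hg max_convexD(1)[OF D(1)] by auto
    then show "y \<in> ?h ` C" using gD y by (intro image_eqI[of _ ?h "?g y"]) auto
  qed
  then have "?h ` C = D" using hD by (rule subset_antisym[rotated])
  then show ?thesis using D(1) by (rule ssubst)
qed

text \<open>Passing from \<open>T\<close> to \<open>\<lambda>x. - T (- x)\<close> is an involution,
  so the previous lemma applied to the opposite map speaks of \<open>T\<close>.\<close>

theorem sphere_isometry_max_convex:
  fixes T :: "'a::complex_banach \<Rightarrow> 'b::complex_banach"
  assumes "sphere_isometry T" "C \<in> max_convex_subsets"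
  shows "T ` C \<in> max_convex_subsets"
  using opposite_image_max_convex[OF sphere_isometry_opposite[OF assms(1)] assms(2)] by simp

section \<open>The faces of one functional\<close>

lemma Fset_scaleC:
  assumes p: "p \<in> dual_unit_ball" and c: "cmod c = 1"
  shows "(*\<^sub>C) c ` Fset p l = Fset p (c * l)"
proof (intro equalityI subsetI)
  have inv: "c * cnj c = 1" using c complex_norm_square[of c] by simp
  fix x assume x: "x \<in> Fset p (c * l)"
  have "cnj c *\<^sub>C x \<in> Fset p l"
    using x c inv by (simp add: Fset_def norm_scaleC dual_unit_ballD[OF p] mult.assoc[symmetric] mult.commute[of "cnj c"])
  moreover have "c *\<^sub>C cnj c *\<^sub>C x = x" by (simp add: scaleC_scaleC inv)
  ultimately show "x \<in> (*\<^sub>C) c ` Fset p l" by (intro image_eqI[of _ _ "cnj c *\<^sub>C x"]) simp_all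
qed (use c in \<open>auto simp: Fset_def norm_scaleC dual_unit_ballD[OF p]\<close>)

lemma Fset_eq_scaleC_face:
  assumes "p \<in> dual_unit_ball" "cmod l = 1"
  shows "Fset p l = (*\<^sub>C) l ` face (blinfun_apply p)"
  using Fset_scaleC[OF assms, of 1] by (simp add: Fset_one)

text \<open>Lets \<open>same_face_by\<close> be read as an equality between sets
  \<open>Fset\<close>, with the unimodular factor conjugated.\<close>

lemma face_scaled:
  assumes "cmod c = 1"
  shows "face (\<lambda>a. c * blinfun_apply p a) = Fset p (cnj c)"
proof -
  have inv: "c * cnj c = 1" using assms complex_norm_square[of c] by simp
  have "c * z = 1 \<longleftrightarrow> z = cnj c" for z
  proof
    assume "c * z = 1"
    then have "c * z = c * cnj c" using inv by simp
    then show "z = cnj c" using assms by auto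
  qed (use inv in simp)
  then show ?thesis by (auto simp: face_def Fset_def)
qed

text \<open>A functional of norm at most 1 does not increase distances. Nonemptiness excludes the
  default value 0 of \<open>infdist\<close>.\<close>

lemma infdist_Fset_ge:
  assumes p: "p \<in> dual_unit_ball" and ne: "Fset p l \<noteq> {}"
  shows "cmod (blinfun_apply p x - l) \<le> infdist x (Fset p l)"
  unfolding infdist_notempty[OF ne]
proof (rule cINF_greatest[OF ne])
  fix y assume "y \<in> Fset p l"
  then have "blinfun_apply p x - l = blinfun_apply p (x - y)" by (simp add: Fset_def blinfun.diff_right)
  then show "cmod (blinfun_apply p x - l) \<le> dist x y"
    using dual_unit_ballD(2)[OF p, of "x - y"] by (simp add: dist_norm)
qed

text \<open>Rotating a point of \<open>Fset p c\<close> by \<open>d * cnj c\<close> reaches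
  \<open>Fset p d\<close> at distance \<open>cmod (c - d)\<close>, and \<open>p\<close> forbids
  anything shorter; both suprema are thus over constants. The argument works in every complex Banach
  space, in particular in the target of \<open>T\<close>.\<close>

lemma hausdorff_distance_Fset:
  assumes p: "p \<in> dual_unit_ball" and ne: "face (blinfun_apply p) \<noteq> {}"
    and ab: "cmod a = 1" "cmod b = 1"
  shows "hausdorff_distance (Fset p a) (Fset p b) = cmod (a - b)"
proof -
  have nonempty: "Fset p l \<noteq> {}" if "cmod l = 1" for l
    using ne by (simp add: Fset_eq_scaleC_face[OF p that])
  have "infdist x (Fset p d) = cmod (c - d)" if cd: "cmod c = 1" "cmod d = 1" and x: "x \<in> Fset p c" for c d x
  proof (rule antisym)
    have "d * cnj c * c = d" using cd complex_norm_square[of c] by (simp add: mult.assoc mult.commute[of "cnj c"])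
    then have "(d * cnj c) *\<^sub>C x \<in> Fset p d"
      using Fset_scaleC[OF p, of "d * cnj c" c] imageI[OF x, of "(*\<^sub>C) (d * cnj c)"] cd
      by (metis complex_mod_cnj mult_1 norm_mult)
    then have le: "infdist x (Fset p d) \<le> dist x ((d * cnj c) *\<^sub>C x)" by (rule infdist_le)
    have "x - (d * cnj c) *\<^sub>C x = (1 - d * cnj c) *\<^sub>C x"
      using scaleC_add_left[of "1 - d * cnj c" "d * cnj c" x]
      by (metis add_diff_cancel_right' diff_add_cancel scaleC_one)
    then have "dist x ((d * cnj c) *\<^sub>C x) = cmod (1 - d * cnj c)"
      using x by (simp add: dist_norm norm_scaleC Fset_def)
    also have "\<dots> = cmod (c * (1 - d * cnj c))" using cd by (simp add: norm_mult)
    also have "c * (1 - d * cnj c) = c - d" using \<open>d * cnj c * c = d\<close> by (simp add: algebra_simps)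
    finally show "infdist x (Fset p d) \<le> cmod (c - d)" using le by simp
    show "cmod (c - d) \<le> infdist x (Fset p d)"
      using infdist_Fset_ge[OF p nonempty[OF cd(2)], of x] x by (simp add: Fset_def)
  qed
  then have "(SUP x\<in>Fset p a. infdist x (Fset p b)) = cmod (a - b)"
    "(SUP x\<in>Fset p b. infdist x (Fset p a)) = cmod (b - a)"
    using ab nonempty by simp_all
  then show ?thesis by (simp add: hausdorff_distance_def norm_minus_commute)
qed

section \<open>Distances under isometries and the geometry of the circle\<close>

lemma sphere_isometry_infdist:
  assumes "sphere_isometry T" "L \<subseteq> sphere 0 1" "norm x = 1"
  shows "infdist (T x) (T ` L) = infdist x L"
proof -
  have "dist (T x) (T y) = dist x y" if "y \<in> L" for y
    using assms that by (intro sphere_isometry_dist) auto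
  then have "(\<lambda>y. dist (T x) (T y)) ` L = dist x ` L" by (intro image_cong) auto
  then show ?thesis by (simp add: infdist_def image_image)
qed

lemma sphere_isometry_hausdorff_distance:
  assumes "sphere_isometry T" "K \<subseteq> sphere 0 1" "L \<subseteq> sphere 0 1"
  shows "hausdorff_distance (T ` K) (T ` L) = hausdorff_distance K L"
proof -
  have "(SUP x\<in>M. infdist (T x) (T ` N)) = (SUP x\<in>M. infdist x N)"
    if "M \<subseteq> sphere 0 1" "N \<subseteq> sphere 0 1" for M N
    using that sphere_isometry_infdist[OF assms(1) that(2)] by (intro SUP_cong) auto
  then show ?thesis using assms by (simp add: hausdorff_distance_def image_image)
qed

text \<open>After division by \<open>\<tau> 1\<close> the map fixes 1 and preserves inner products,
  so it is the identity or conjugation. The inverse is returned because \<open>\<tau>\<close> will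
  describe pullbacks while \<open>R\<close> has to follow \<open>T\<close> forward.\<close>

lemma circle_isometry_inverse_linear:
  fixes \<tau> :: "complex \<Rightarrow> complex"
  assumes norm: "\<And>z. cmod z = 1 \<Longrightarrow> cmod (\<tau> z) = 1"
    and dist: "\<And>z w. cmod z = 1 \<Longrightarrow> cmod w = 1 \<Longrightarrow> cmod (\<tau> z - \<tau> w) = cmod (z - w)"
  obtains R where "linear R" "\<And>z. cmod (R z) = cmod z" "\<And>z. cmod z = 1 \<Longrightarrow> \<tau> (R z) = z"
proof -
  define \<sigma> where "\<sigma> z = cnj (\<tau> 1) * \<tau> z" for z
  have inv: "\<tau> 1 * cnj (\<tau> 1) = 1" using norm[of 1] complex_norm_square[of "\<tau> 1"] by simp
  have \<tau>: "\<tau> z = \<tau> 1 * \<sigma> z" for z by (simp add: \<sigma>_def inv mult.assoc[symmetric])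
  have \<sigma>1: "\<sigma> 1 = 1" using inv by (simp add: \<sigma>_def mult.commute)
  have ns: "(Re (\<sigma> z))\<^sup>2 + (Im (\<sigma> z))\<^sup>2 = 1" if "cmod z = 1" for z
  proof -
    have "cmod (\<sigma> z) = 1" using norm[OF that] norm[of 1] by (simp add: \<sigma>_def norm_mult)
    then show ?thesis using cmod_power2[of "\<sigma> z"] by simp
  qed
  have ds: "(Re (\<sigma> z) - Re (\<sigma> w))\<^sup>2 + (Im (\<sigma> z) - Im (\<sigma> w))\<^sup>2 = (Re z - Re w)\<^sup>2 + (Im z - Im w)\<^sup>2"
    if "cmod z = 1" "cmod w = 1" for z w
  proof -
    have "cmod (\<sigma> z - \<sigma> w) = cmod (z - w)"
      using dist[OF that] norm[of 1] by (simp add: \<sigma>_def norm_mult flip: right_diff_distrib)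
    then show ?thesis by (metis cmod_power2 minus_complex.simps)
  qed
  have n: "(Re z)\<^sup>2 + (Im z)\<^sup>2 = 1" if "cmod z = 1" for z using that by (simp flip: cmod_power2)
  \<comment> \<open>Polarisation: distances between unit vectors determine their inner
    products.\<close>
  have inner: "Re (\<sigma> z) * Re (\<sigma> w) + Im (\<sigma> z) * Im (\<sigma> w) = Re z * Re w + Im z * Im w"
    if "cmod z = 1" "cmod w = 1" for z w
    using ds[OF that] ns[OF that(1)] ns[OF that(2)] n[OF that(1)] n[OF that(2)]
    by (simp add: power2_diff)
  have Re: "Re (\<sigma> z) = Re z" if "cmod z = 1" for z using inner[OF that, of 1] \<sigma>1 by simp
  have \<sigma>i: "Re (\<sigma> \<i>) = 0" "Im (\<sigma> \<i>) = 1 \<or> Im (\<sigma> \<i>) = - 1"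
    using Re[of \<i>] ns[of \<i>] by (simp_all add: power2_eq_1_iff)
  have Im: "Im (\<sigma> z) * Im (\<sigma> \<i>) = Im z" if "cmod z = 1" for z using inner[OF that, of \<i>] \<sigma>i by simp
  show thesis
  proof (cases "Im (\<sigma> \<i>) = 1")
    case True
    have "\<sigma> z = z" if "cmod z = 1" for z using Re[OF that] Im[OF that] True by (simp add: complex_eq_iff)
    then have "\<tau> (cnj (\<tau> 1) * z) = z" if "cmod z = 1" for z
      using \<tau>[of "cnj (\<tau> 1) * z"] norm[of 1] that inv by (simp add: norm_mult mult.assoc[symmetric])
    then show thesis using norm[of 1]
      by (intro that[of "\<lambda>z. cnj (\<tau> 1) * z"]) (auto simp: norm_mult intro!: linearI simp: algebra_simps)
  next
    case False
    then have "Im (\<sigma> \<i>) = - 1" using \<sigma>i by simp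
    then have "\<sigma> z = cnj z" if "cmod z = 1" for z using Re[OF that] Im[OF that] by (auto simp: complex_eq_iff)
    \<comment> \<open>In this case \<open>\<tau>\<close> is a reflection and its own
      inverse.\<close>
    then have "\<tau> (\<tau> 1 * cnj z) = z" if "cmod z = 1" for z
      using \<tau>[of "\<tau> 1 * cnj z"] norm[of 1] that inv by (simp add: norm_mult mult.assoc[symmetric])
    then show thesis using norm[of 1]
      by (intro that[of "\<lambda>z. \<tau> 1 * cnj z"]) (auto simp: norm_mult intro!: linearI simp: algebra_simps)
  qed
qed

text \<open>The radii \<open>1 - r\<close> and \<open>1 + r\<close> add up to the distance of the
  centres \<open>m\<close> and \<open>- m\<close>, so in an inner product space the two balls touch
  in the single point \<open>r *\<^sub>R m\<close>.\<close>

lemma between_opposite_points: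
  fixes z m :: "'a::real_inner"
  assumes m: "norm m = 1" and r: "0 \<le> r" "r \<le> 1" and d: "norm (z - m) \<le> 1 - r" "norm (z + m) \<le> 1 + r"
  shows "z = r *\<^sub>R m"
proof -
  have mm: "m \<bullet> m = 1" using m by (simp add: dot_square_norm)
  have "(norm (z - m))\<^sup>2 \<le> (1 - r)\<^sup>2" "(norm (z + m))\<^sup>2 \<le> (1 + r)\<^sup>2"
    using d r by (intro power_mono; simp)+
  then have 1: "z \<bullet> z - 2 * (z \<bullet> m) + 1 \<le> (1 - r)\<^sup>2" and 2: "z \<bullet> z + 2 * (z \<bullet> m) + 1 \<le> (1 + r)\<^sup>2"
    using mm by (simp_all add: power2_norm_eq_inner inner_diff inner_add inner_commute algebra_simps)
  have 3: "z \<bullet> z \<le> r\<^sup>2" using 1 2 by (simp add: power2_eq_square algebra_simps)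
  have "(norm (z - r *\<^sub>R m))\<^sup>2 = z \<bullet> z - 2 * r * (z \<bullet> m) + r\<^sup>2"
    unfolding power2_norm_eq_inner
    using mm by (simp add: inner_diff inner_commute power2_eq_square algebra_simps)
  \<comment> \<open>This regrouping combines the first bound with
    \<open>z \<bullet> z \<le> r\<^sup>2\<close>, the average of both bounds, so that the estimate
    cancels to 0.\<close>
  also have "\<dots> = r * (z \<bullet> z - 2 * (z \<bullet> m) + 1) + (1 - r) * (z \<bullet> z) + r\<^sup>2 - r"
    by (simp add: algebra_simps)
  also have "\<dots> \<le> r * (1 - r)\<^sup>2 + (1 - r) * r\<^sup>2 + r\<^sup>2 - r"
    using mult_left_mono[OF 1 r(1)] mult_left_mono[OF 3, of "1 - r"] r by simp
  also have "\<dots> = 0" by (simp add: power2_eq_square algebra_simps)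
  finally show ?thesis by simp
qed

section \<open>Pulling functionals back to a single representative\<close>

lemma same_face_by_trans:
  assumes pqr: "p \<in> dual_unit_ball" "q \<in> dual_unit_ball" "r \<in> dual_unit_ball"
    and c: "cmod c = 1" "same_face_by c p q" and d: "cmod d = 1" "same_face_by d q r"
  shows "same_face_by (c * d) p r"
proof -
  have "Fset p 1 = Fset q (cnj c)" using c face_scaled[OF c(1), of q] by (simp add: same_face_by_def Fset_one)
  also have "\<dots> = (*\<^sub>C) (cnj c) ` Fset q 1" using Fset_scaleC[OF pqr(2), of "cnj c" 1] c by simp
  also have "Fset q 1 = Fset r (cnj d)" using d face_scaled[OF d(1), of r] by (simp add: same_face_by_def Fset_one)
  also have "(*\<^sub>C) (cnj c) ` \<dots> = Fset r (cnj c * cnj d)" using Fset_scaleC[OF pqr(3), of "cnj c"] c by simp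
  finally show ?thesis using face_scaled[of "c * d" r] c d by (simp add: same_face_by_def Fset_one norm_mult)
qed

lemma face_equiv_trans: "(p, q) \<in> face_equiv \<Longrightarrow> (q, r) \<in> face_equiv \<Longrightarrow> (p, r) \<in> face_equiv"
proof -
  assume h: "(p, q) \<in> face_equiv" "(q, r) \<in> face_equiv"
  then obtain c d where cd: "cmod c = 1" "same_face_by c p q" "cmod d = 1" "same_face_by d q r"
    and Q: "p \<in> Qset" "q \<in> Qset" "r \<in> Qset"
    by (auto simp: face_equiv_def)
  have "same_face_by (c * d) p r"
    using same_face_by_trans[OF Qset_dual_unit_ball[OF Q(1)] Qset_dual_unit_ball[OF Q(2)] Qset_dual_unit_ball[OF Q(3)] cd] .
  moreover have "c * d \<in> sphere 0 1" using cd by (simp add: norm_mult)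
  ultimately show ?thesis using Q unfolding face_equiv_def by blast
qed

lemma representative_of_Qset:
  assumes P: "set_of_representatives P" and q: "q \<in> Qset"
  obtains p where "p \<in> P" "(q, p) \<in> face_equiv"
proof -
  have "face_equiv `` {q} \<in> Qset // face_equiv" using q by (rule quotientI)
  then obtain p where "p \<in> P \<inter> face_equiv `` {q}" using P unfolding set_of_representatives_def by blast
  then show thesis by (intro that[of p]) auto
qed

text \<open>The inverse of \<open>T\<close> turns each \<open>Fset q l\<close> into the face of some
  \<open>p' l\<close>. Inequivalent faces are at Hausdorff distance 2, so faces that are closer are
  equivalent; hence one \<open>p\<close> serves all \<open>l\<close>, and comparing Hausdorff
  distances makes the resulting map \<open>\<tau>\<close> of the circle an isometry.\<close>

lemma sphere_isometry_faces:
  fixes T :: "'a::complex_banach \<Rightarrow> 'b::complex_banach" and P :: "('a \<Rightarrow>\<^sub>L complex) set"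
  assumes T: "sphere_isometry T" and P: "set_of_representatives P"
    and H: "hausdorff_distance_condition TYPE('a)"
    and q: "q \<in> Qset" and ne: "face (blinfun_apply q) \<noteq> {}"
  obtains p R where "p \<in> P" "linear R" "\<And>z. cmod (R z) = cmod z"
    "\<And>\<mu>. cmod \<mu> = 1 \<Longrightarrow> T ` Fset p \<mu> = Fset q (R \<mu>)"
proof -
  have qb: "q \<in> dual_unit_ball" and qf: "face (blinfun_apply q) \<in> max_convex_subsets"
    using q Qset_dual_unit_ball by (auto simp: Qset_def)
  obtain k where k: "sphere_isometry k" "\<And>x. norm x = 1 \<Longrightarrow> k (T x) = x" "\<And>y. norm y = 1 \<Longrightarrow> T (k y) = y"
    by (rule sphere_isometry_inverse[OF T]) (rule that)
  have Fs: "Fset r l \<subseteq> sphere 0 1" for r :: "'c::complex_banach \<Rightarrow>\<^sub>L complex" and l by (auto simp: Fset_def)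
  have "\<exists>p. p \<in> Qset \<and> face (blinfun_apply p) = k ` Fset q l" if l: "cmod l = 1" for l
  proof -
    have eq: "Fset q l = (*\<^sub>C) l ` face (blinfun_apply q)" by (rule Fset_eq_scaleC_face[OF qb l])
    have "k ` Fset q l \<in> max_convex_subsets"
      unfolding eq by (intro sphere_isometry_max_convex[OF k(1)] max_convex_scaleC qf l)
    moreover have "k ` Fset q l \<noteq> {}" using ne by (simp add: eq)
    ultimately show ?thesis using max_convex_subsets_imp_face by metis
  qed
  then obtain p' where p': "\<And>l. cmod l = 1 \<Longrightarrow> p' l \<in> Qset"
    "\<And>l. cmod l = 1 \<Longrightarrow> Fset (p' l) 1 = k ` Fset q l"
    unfolding Fset_one by metis
  have hd: "hausdorff_distance (k ` Fset q l) (k ` Fset q m) = cmod (l - m)" if "cmod l = 1" "cmod m = 1" for l m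
    using sphere_isometry_hausdorff_distance[OF k(1) Fs Fs] hausdorff_distance_Fset[OF qb ne that] by simp
  have equiv: "(p' l, p' m) \<in> face_equiv" if lm: "cmod l = 1" "cmod m = 1" and "cmod (l - m) \<noteq> 2" for l m
  proof (rule ccontr)
    assume "(p' l, p' m) \<notin> face_equiv"
    then have "hausdorff_distance (Fset (p' l) 1) (Fset (p' m) 1) = 2"
      using H p'(1)[OF lm(1)] p'(1)[OF lm(2)] unfolding hausdorff_distance_condition_def by simp
    then show False using that hd p'(2) by simp
  qed
  \<comment> \<open>Only \<open>- 1\<close> is at distance 2 from 1 on the circle, where the
    distance decides nothing. The point \<open>\<i>\<close>, at distance less than 2 from both,
    links the two faces.\<close>
  have equiv1: "(p' l, p' 1) \<in> face_equiv" if l: "cmod l = 1" for l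
  proof (cases "l = - 1")
    case True
    have "(cmod (l - \<i>))\<^sup>2 = 2" "(cmod (\<i> - 1))\<^sup>2 = 2" unfolding True cmod_power2 by simp_all
    then have "cmod (l - \<i>) \<noteq> 2" "cmod (\<i> - 1) \<noteq> 2" by auto
    then show ?thesis using equiv[of l \<i>] equiv[of \<i> 1] l face_equiv_trans by force
  next
    case False
    have "cmod (l - 1) \<noteq> 2"
    proof
      assume "cmod (l - 1) = 2"
      then have "(Re l - 1)\<^sup>2 + (Im l)\<^sup>2 = 4" using cmod_power2[of "l - 1"] by simp
      moreover have n: "(Re l)\<^sup>2 + (Im l)\<^sup>2 = 1" using l by (simp flip: cmod_power2)
      ultimately have "Re l = - 1" by (simp add: power2_diff)
      then show False using n False by (simp add: complex_eq_iff)
    qed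
    then show ?thesis using equiv l by simp
  qed
  obtain p where p: "p \<in> P" "(p' 1, p) \<in> face_equiv" using representative_of_Qset[OF P p'(1)[of 1]] by auto
  have pQ: "p \<in> Qset" using p by (simp add: face_equiv_def)
  have pb: "p \<in> dual_unit_ball" using pQ by (rule Qset_dual_unit_ball)
  have "\<exists>t. cmod t = 1 \<and> k ` Fset q l = Fset p t" if l: "cmod l = 1" for l
  proof -
    have "(p' l, p) \<in> face_equiv" using face_equiv_trans[OF equiv1[OF l] p(2)] .
    then obtain c where c: "cmod c = 1" "same_face_by c (p' l) p" by (auto simp: face_equiv_def)
    then have "k ` Fset q l = Fset p (cnj c)"
      using face_scaled[OF c(1), of p] p'(2)[OF l] by (simp add: same_face_by_def Fset_one)
    then show ?thesis using c by (intro exI[of _ "cnj c"]) simp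
  qed
  then obtain \<tau> where \<tau>: "\<And>l. cmod l = 1 \<Longrightarrow> cmod (\<tau> l) = 1" "\<And>l. cmod l = 1 \<Longrightarrow> k ` Fset q l = Fset p (\<tau> l)"
    by metis
  have pne: "face (blinfun_apply p) \<noteq> {}"
  proof -
    have "Fset p (\<tau> 1) \<noteq> {}" using \<tau>(2)[of 1] ne by (simp add: Fset_one flip: \<tau>(2))
    then show ?thesis using Fset_eq_scaleC_face[OF pb \<tau>(1)[of 1]] by auto
  qed
  have "cmod (\<tau> l - \<tau> m) = cmod (l - m)" if lm: "cmod l = 1" "cmod m = 1" for l m
    using hd[OF lm] hausdorff_distance_Fset[OF pb pne \<tau>(1)[OF lm(1)] \<tau>(1)[OF lm(2)]] \<tau>(2) lm by simp
  then obtain R where R: "linear R" "\<And>z. cmod (R z) = cmod z" "\<And>z. cmod z = 1 \<Longrightarrow> \<tau> (R z) = z"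
    using circle_isometry_inverse_linear[of \<tau>] \<tau>(1) by blast
  have "T ` Fset p \<mu> = Fset q (R \<mu>)" if "cmod \<mu> = 1" for \<mu>
  proof -
    have "k ` Fset q (R \<mu>) = Fset p \<mu>" using \<tau>(2)[of "R \<mu>"] R that by simp
    then have "T ` Fset p \<mu> = (\<lambda>y. T (k y)) ` Fset q (R \<mu>)" by (metis image_image)
    also have "\<dots> = (\<lambda>y. y) ` Fset q (R \<mu>)" using k(3) by (intro image_cong) (auto simp: Fset_def)
    finally show ?thesis by simp
  qed
  then show thesis using p(1) R(1,2) by (intro that)
qed

text \<open>Membership in \<open>Mset p \<alpha>\<close> bounds the distances from \<open>a\<close>
  to two opposite faces. \<open>T\<close> carries these to faces of \<open>q\<close>, which puts
  \<open>q (T a)\<close> in two touching discs about \<open>R \<mu>\<close> and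
  \<open>- R \<mu>\<close>, leaving one possible value.\<close>

lemma sphere_isometry_functional:
  fixes T :: "'a::complex_banach \<Rightarrow> 'b::complex_banach" and P :: "('a \<Rightarrow>\<^sub>L complex) set"
  assumes T: "sphere_isometry T" and P: "set_of_representatives P"
    and H: "hausdorff_distance_condition TYPE('a)"
    and M: "\<And>p \<alpha>. p \<in> P \<Longrightarrow> cmod \<alpha> \<le> 1 \<Longrightarrow> {a \<in> sphere 0 1. blinfun_apply p a = \<alpha>} \<subseteq> Mset p \<alpha>"
    and q: "q \<in> Qset" and ne: "face (blinfun_apply q) \<noteq> {}"
  obtains p R where "p \<in> P" "linear R"
    "\<And>a. norm a = 1 \<Longrightarrow> blinfun_apply q (T a) = R (blinfun_apply p a)"
proof -
  obtain p R where p: "p \<in> P" and R: "linear R" "\<And>z. cmod (R z) = cmod z"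
    and F: "\<And>\<mu>. cmod \<mu> = 1 \<Longrightarrow> T ` Fset p \<mu> = Fset q (R \<mu>)"
    by (rule sphere_isometry_faces[OF T P H q ne]) (rule that)
  have pb: "p \<in> dual_unit_ball" using p P by (auto simp: set_of_representatives_def intro: Qset_dual_unit_ball)
  have qb: "q \<in> dual_unit_ball" using q by (rule Qset_dual_unit_ball)
  have dist: "cmod (blinfun_apply q (T a) - R \<mu>) \<le> infdist a (Fset p \<mu>)"
    if a: "norm a = 1" and \<mu>: "cmod \<mu> = 1" for a \<mu>
  proof -
    have "Fset q (R \<mu>) \<noteq> {}" using ne Fset_eq_scaleC_face[OF qb, of "R \<mu>"] R(2) \<mu> by simp
    then have "cmod (blinfun_apply q (T a) - R \<mu>) \<le> infdist (T a) (T ` Fset p \<mu>)"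
      using infdist_Fset_ge[OF qb] F[OF \<mu>] by simp
    also have "\<dots> = infdist a (Fset p \<mu>)"
      by (rule sphere_isometry_infdist[OF T _ a]) (auto simp: Fset_def)
    finally show ?thesis .
  qed
  have "blinfun_apply q (T a) = R (blinfun_apply p a)" if a: "norm a = 1" for a
  proof -
    define \<alpha> where "\<alpha> = blinfun_apply p a"
    have \<alpha>: "cmod \<alpha> \<le> 1" using dual_unit_ballD(2)[OF pb, of a] a by (simp add: \<alpha>_def)
    define \<mu> where "\<mu> = phase \<alpha>"
    have \<mu>: "cmod \<mu> = 1" by (simp add: \<mu>_def phase_def norm_divide)
    \<comment> \<open>At \<open>\<alpha> = 0\<close> the phase is 1, so the polar form holds there
      as well.\<close>
    have eq: "\<alpha> = cmod \<alpha> *\<^sub>R \<mu>" by (simp add: \<mu>_def phase_def scaleR_conv_of_real)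
    have "a \<in> Mset p \<alpha>" using M[OF p \<alpha>] a by (auto simp: \<alpha>_def)
    then have "infdist a (Fset p \<mu>) \<le> 1 - cmod \<alpha>" "infdist a (Fset p (- \<mu>)) \<le> 1 + cmod \<alpha>"
      by (auto simp: Mset_def \<mu>_def)
    then have "cmod (blinfun_apply q (T a) - R \<mu>) \<le> 1 - cmod \<alpha>"
      "cmod (blinfun_apply q (T a) + R \<mu>) \<le> 1 + cmod \<alpha>"
      using dist[OF a \<mu>] dist[OF a, of "- \<mu>"] \<mu> linear_neg[OF R(1), of \<mu>] by simp_all
    then have "blinfun_apply q (T a) = cmod \<alpha> *\<^sub>R R \<mu>"
      by (intro between_opposite_points) (use \<alpha> \<mu> R(2) in simp_all)
    also have "\<dots> = R \<alpha>" using linear_cmul[OF R(1), of "cmod \<alpha>" \<mu>] eq by simp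
    finally show ?thesis by (simp add: \<alpha>_def)
  qed
  then show thesis by (rule that[OF p R(1)])
qed

section \<open>Separation of points and the homogeneous extension\<close>

lemma Qset_norming:
  fixes b :: "'b::complex_banach"
  assumes "b \<noteq> 0"
  obtains q where "q \<in> Qset" "face (blinfun_apply q) \<noteq> {}" "blinfun_apply q b \<noteq> 0"
proof -
  \<comment> \<open>A maximal convex set through the direction of \<open>b\<close> is the face of
    some \<open>q\<close>, which takes the value 1 at that direction.\<close>
  obtain F where F: "F \<in> max_convex_subsets" "{b /\<^sub>R norm b} \<subseteq> F"
    by (rule max_convex_superset[of "{b /\<^sub>R norm b}"]) (use assms in auto)
  then have "F \<noteq> {}" by auto
  with F(1) obtain q where q: "q \<in> Qset" "face (blinfun_apply q) = F" by (rule max_convex_subsets_imp_face)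
  have "blinfun_apply q (b /\<^sub>R norm b) = 1" using q(2) F(2) by (auto simp: face_def)
  then have "blinfun_apply q b \<noteq> 0" by (auto simp: blinfun.scaleR_right)
  then show thesis using q \<open>F \<noteq> {}\<close> by (intro that) simp_all
qed

theorem proposition4p4:
  fixes P\<^sub>1 :: "('a::complex_banach \<Rightarrow>\<^sub>L complex) set"
  assumes "set_of_representatives P\<^sub>1"
    and "hausdorff_distance_condition TYPE('a)"
    and "\<And>p \<alpha>. p \<in> P\<^sub>1 \<Longrightarrow> cmod \<alpha> \<le> 1 \<Longrightarrow>
           Mset p \<alpha> = {a \<in> sphere 0 1. blinfun_apply p a = \<alpha>}"
  shows "complex_mazur_ulam_property TYPE('a) TYPE('b::complex_banach)"
  unfolding complex_mazur_ulam_property_def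
proof (intro allI impI)
  fix T :: "'a \<Rightarrow> 'b"
  assume "T ` sphere 0 1 = sphere 0 1 \<and> (\<forall>x\<in>sphere 0 1. \<forall>y\<in>sphere 0 1. dist (T x) (T y) = dist x y)"
  then have T: "sphere_isometry T" by (simp add: sphere_isometry_def)
  \<comment> \<open>At 0 the factor \<open>norm x\<close> makes the value 0, whatever
    \<open>T\<close> does off the sphere.\<close>
  define U where "U x = norm x *\<^sub>R T (x /\<^sub>R norm x)" for x
  have norm_U: "norm (U x) = norm x" for x
    using sphere_isometry_norm[OF T, of "x /\<^sub>R norm x"] by (cases "x = 0") (simp_all add: U_def)
  have functional: "\<exists>(p :: 'a \<Rightarrow>\<^sub>L complex) (R :: complex \<Rightarrow> complex). linear R \<and> (\<forall>x. blinfun_apply q (U x) = R (blinfun_apply p x))"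
    if q: "q \<in> Qset" "face (blinfun_apply q) \<noteq> {}" for q :: "'b \<Rightarrow>\<^sub>L complex"
  proof -
    obtain p R where "p \<in> P\<^sub>1"
      and R: "linear R" "\<And>a. norm a = 1 \<Longrightarrow> blinfun_apply q (T a) = R (blinfun_apply p a)"
      by (rule sphere_isometry_functional[OF T assms(1,2) equalityD2[OF assms(3)] q]) (assumption, assumption, rule that)
    have "blinfun_apply q (U x) = R (blinfun_apply p x)" for x
      using R(2)[of "x /\<^sub>R norm x"]
      by (cases "x = 0") (simp_all add: U_def blinfun.scaleR_right linear_cmul[OF R(1)] linear_0[OF R(1)])
    then show ?thesis using R(1) by blast
  qed
  have "linear U"
  proof (rule linearI)
    fix x y
    show "U (x + y) = U x + U y"
    \<comment> \<open>A nonzero defect would be seen by some \<open>q\<close> with nonempty face,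
      but \<open>q\<close> composed with \<open>U\<close> is \<open>R\<close> composed with
      \<open>p\<close>, which is additive. Homogeneity is treated the same way below.\<close>
    proof (rule ccontr)
      assume "U (x + y) \<noteq> U x + U y"
      then obtain q where q: "q \<in> Qset" "face (blinfun_apply q) \<noteq> {}"
        "blinfun_apply q (U (x + y) - (U x + U y)) \<noteq> 0"
        using Qset_norming[of "U (x + y) - (U x + U y)"] by auto
      then show False using functional[OF q(1,2)]
        by (auto simp: blinfun.diff_right blinfun.add_right linear_add)
    qed
  next
    fix r x
    show "U (r *\<^sub>R x) = r *\<^sub>R U x"
    proof (rule ccontr)
      assume "U (r *\<^sub>R x) \<noteq> r *\<^sub>R U x"
      then obtain q where q: "q \<in> Qset" "face (blinfun_apply q) \<noteq> {}"
        "blinfun_apply q (U (r *\<^sub>R x) - r *\<^sub>R U x) \<noteq> 0"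
        using Qset_norming[of "U (r *\<^sub>R x) - r *\<^sub>R U x"] by auto
      then show False using functional[OF q(1,2)]
        by (auto simp: blinfun.diff_right blinfun.scaleR_right linear_cmul)
    qed
  qed
  moreover have "surj U"
  proof -
    have "\<exists>x. U x = y" for y
    proof (cases "y = 0")
      case True
      then show ?thesis using norm_U[of 0] by (intro exI[of _ 0]) simp
    next
      case False
      then have "y /\<^sub>R norm y \<in> T ` sphere 0 1" using T by (simp add: sphere_isometry_def)
      then obtain a where "norm a = 1" "T a = y /\<^sub>R norm y" by auto
      then have "U (norm y *\<^sub>R a) = y" using False by (simp add: U_def)
      then show ?thesis by blast
    qed
    then show ?thesis by (metis surjI)
  qed
  \<comment> \<open>For the now linear \<open>U\<close>, preservation of norms gives preservation of
    distances.\<close>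
  moreover have "dist (U x) (U y) = dist x y" for x y
    using norm_U[of "x - y"] linear_diff[OF \<open>linear U\<close>, of x y] by (simp add: dist_norm)
  moreover have "U x = T x" if "x \<in> sphere 0 1" for x
    using that by (simp add: U_def)
  ultimately show "\<exists>U. linear U \<and> surj U \<and> (\<forall>x y. dist (U x) (U y) = dist x y) \<and> (\<forall>x\<in>sphere 0 1. U x = T x)"
    by blast
qed

end
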